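(* For every $(\alpha,h)\in\mathcal{U}^{rs}$, $$\frac{2S_n}{n^2}\longrightarrow u^*(\alpha,h)\quad\text{almost surely with respect to } \mathbb{P}_{\alpha,h},\ \text{ as } n\to+\infty,$$ where $u^*(\alpha,h)$ is the unique maximizer of $u\mapsto \frac{\alpha}{6}u^3+\frac h2 u-\frac12 I(u)$ on $[0,1]$.
   Context: Edge-triangle model. For $n\in\mathbb{N}$ let $\mathcal{E}_n$ be the edge set of the complete graph on $n$ labeled vertices (so $|\mathcal{E}_n|=\binom n2$), let $\mathcal{T}_n$ be the set of triples $\{i,j,k\}\subset\mathcal{E}_n$ of edges forming a triangle, and let $\mathcal{A}_n=\{0,1\}^{\mathcal{E}_n}$ (identified with simple graphs on $n$ labeled vertices). For $\alpha,h\in\mathbb{R}$ and $x\in\mathcal{A}_n$ set $\mathcal{H}_{n;\alpha,h}(x)=\frac{\alpha}{n}\sum_{\{i,j,k\}\in\mathcal{T}_n}x_ix_jx_k+h\sum_{i\in\mathcal{E}_n}x_i$. Let $\mathbb{P}_{n;\alpha,h}$ be the probability measure on $\mathcal{A}_n$ with density $e^{\mathcal{H}_{n;\alpha,h}(x)}/Z_{n;\alpha,h}$, $Z_{n;\alpha,h}=\sum_{x\in\mathcal{A}_n}e^{\mathcal{H}_{n;\alpha,h}(x)}$, and let $S_n(x)=\sum_{i\in\mathcal{E}_n}x_i$ be the number of edges. Let $I(u)=u\ln u+(1-u)\ln(1-u)$ on $[0,1]$ (with $0\ln 0=0$). For $\alpha>-2$ consider the scalar problem $\sup_{0\le u\le1}\left(\frac\alpha6u^3+\frac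 h2u-\frac12I(u)\right)$. It is known that it has a unique maximizer except when $(\alpha,h)$ lies on a critical curve $\mathcal{M}^{rs}=\{(\alpha,h):\alpha>\alpha_c,\ h<h_c,\ h=q(\alpha)\}$ ($q$ a continuous, strictly decreasing function), on which there are exactly two maximizers; here $(\alpha_c,h_c)=\left(\frac{27}{8},\ln2-\frac32\right)$, which is the endpoint of the curve and does not belong to $\mathcal{M}^{rs}$. Set $\mathcal{U}^{rs}=\left((-2,+\infty)\times\mathbb{R}\right)\setminus\mathcal{M}^{rs}$. $\mathbb{P}_{\alpha,h}$ denotes any probability measure on a space on which all the random variables $S_n$, $n\ge1$, are jointly defined and such that for each $n$ the law of $S_n$ is its law under $\mathbb{P}_{n;\alpha,h}$. *)

theory Defs
  imports "HOL-Probability.Probability"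
begin

definition edges :: "nat \<Rightarrow> nat set set" where
  "edges n = {e. e \<subseteq> {..<n} \<and> card e = 2}"

definition triangles :: "nat \<Rightarrow> nat set set set" where
  "triangles n = {{{a, b}, {b, c}, {a, c}} | a b c. a < b \<and> b < c \<and> c < n}"

definition configs :: "nat \<Rightarrow> (nat set \<Rightarrow> real) set" where
  "configs n = edges n \<rightarrow>\<^sub>E {0, 1}"

definition edge_count :: "nat \<Rightarrow> (nat set \<Rightarrow> real) \<Rightarrow> real" where
  "edge_count n x = (\<Sum>e\<in>edges n. x e)"

definition hamiltonian :: "real \<Rightarrow> real \<Rightarrow> nat \<Rightarrow> (nat set \<Rightarrow> real) \<Rightarrow> real" where
  "hamiltonian \<alpha> h n x =
     \<alpha> / real n * (\<Sum>t\<in>triangles n. \<Prod>e\<in>t. x e) + h * (\<Sum>e\<in>edges n. x e)"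

definition partition_function :: "real \<Rightarrow> real \<Rightarrow> nat \<Rightarrow> real" where
  "partition_function \<alpha> h n = (\<Sum>x\<in>configs n. exp (hamiltonian \<alpha> h n x))"

definition edge_triangle_measure :: "real \<Rightarrow> real \<Rightarrow> nat \<Rightarrow> (nat set \<Rightarrow> real) measure" where
  "edge_triangle_measure \<alpha> h n = point_measure (configs n)
     (\<lambda>x. ennreal (exp (hamiltonian \<alpha> h n x) / partition_function \<alpha> h n))"

text \<open>The convention \<open>0 ln 0 = 0\<close> holds because \<open>0 * y = 0\<close> in HOL for every real \<open>y\<close>.\<close>

definition entropy_fun :: "real \<Rightarrow> real" where
  "entropy_fun u = u * ln u + (1 - u) * ln (1 - u)"

definition scalar_fun :: "real \<Rightarrow> real \<Rightarrow> real \<Rightarrow> real" where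
  "scalar_fun \<alpha> h u = \<alpha> / 6 * u ^ 3 + h / 2 * u - 1 / 2 * entropy_fun u"

definition maximizers :: "real \<Rightarrow> real \<Rightarrow> real set" where
  "maximizers \<alpha> h = {u. is_arg_max (scalar_fun \<alpha> h) (\<lambda>v. 0 \<le> v \<and> v \<le> 1) u}"

definition u_star :: "real \<Rightarrow> real \<Rightarrow> real" where
  "u_star \<alpha> h = (THE u. u \<in> maximizers \<alpha> h)"

definition alpha_c :: real where
  "alpha_c = 27 / 8"

definition h_c :: real where
  "h_c = ln 2 - 3 / 2"

text \<open>
  For \<open>\<alpha> > alpha_c\<close> the value \<open>crit_field \<alpha>\<close> is the field \<open>h\<close> at which the scalar problem has
  exactly two maximizers; it carries no meaning for the remaining \<open>\<alpha>\<close>.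
\<close>

definition crit_field :: "real \<Rightarrow> real" where
  "crit_field \<alpha> = (THE h. card (maximizers \<alpha> h) = 2)"

definition critical_curve :: "(real \<times> real) set" where
  "critical_curve = {(\<alpha>, h). \<alpha> > alpha_c \<and> h < h_c \<and> h = crit_field \<alpha>}"

definition uniqueness_region :: "(real \<times> real) set" where
  "uniqueness_region = ({-2<..} \<times> UNIV) - critical_curve"

lemma finite_edges: "finite (edges n)"
  by (rule finite_subset[of _ "Pow {..<n}"]) (auto simp: edges_def)

lemma card_edges: "card (edges n) = n choose 2"
  using n_subsets[of "{..<n}" 2] by (simp add: edges_def)

lemma finite_configs: "finite (configs n)"
  by (simp add: configs_def finite_PiE finite_edges)

lemma partition_function_pos: "partition_function \<alpha> h n > 0"
proof -
  have "configs n \<noteq> {}"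
    by (simp add: configs_def PiE_eq_empty_iff)
  then show ?thesis
    by (simp add: partition_function_def finite_configs sum_pos)
qed

lemma prob_space_edge_triangle_measure: "prob_space (edge_triangle_measure \<alpha> h n)"
proof
  have "emeasure (edge_triangle_measure \<alpha> h n) (space (edge_triangle_measure \<alpha> h n)) =
      (\<Sum>x\<in>configs n. ennreal (exp (hamiltonian \<alpha> h n x) / partition_function \<alpha> h n))"
    by (simp add: edge_triangle_measure_def space_point_measure emeasure_point_measure_finite
        finite_configs)
  also have "\<dots> = ennreal (\<Sum>x\<in>configs n. exp (hamiltonian \<alpha> h n x) / partition_function \<alpha> h n)"
    using partition_function_pos[of \<alpha> h n] by (intro sum_ennreal) (simp add: less_imp_le)
  also have "\<dots> = 1"
    using partition_function_pos[of \<alpha> h n]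
    by (simp add: partition_function_def flip: sum_divide_distrib)
  finally show "emeasure (edge_triangle_measure \<alpha> h n) (space (edge_triangle_measure \<alpha> h n)) = 1" .
qed

end

theory Submission
  imports Defs "HOL-Real_Asymp.Real_Asymp"
begin

text \<open>
  The edge density concentrates exponentially fast, at rate \<open>n\<^sup>2\<close>, around the maximizer of the scalar
  problem, because that problem also governs the free energy of the model to leading order.

  \<^emph>\<open>The free energy.\<close> Write \<open>L(u)\<close> for the scalar functional and \<open>m\<close> for its maximum. The heart of
  the matter is that \<open>ln Z\<^sub>n = n\<^sup>2 m + o(n\<^sup>2)\<close> for every \<open>\<alpha> \<ge> -2\<close> and every \<open>h\<close>. The lower bound
  (\<open>partition_function_ge\<close>) is the Gibbs variational principle tested on independent
  edges with density \<open>u\<close>. For the upper bound (\<open>partition_function_le\<close>), apply the variational principle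
  to the Gibbs measure itself, and reveal all edges touching a set \<open>V\<close> of boundedly many vertices.
  This reveals only \<open>O(n)\<close> bits, a negligible amount of entropy on the scale \<open>n\<^sup>2\<close>.
  Let \<open>p\<^sub>e\<close> be the conditional edge
  probabilities. Enlarging \<open>V\<close> increases the mean square of the \<open>p\<^sub>e\<close>, which is bounded, so a suitable
  \<open>V\<close> exists for which revealing one further vertex hardly moves the \<open>p\<^sub>e\<close> in mean square.
  But revealing the vertex \<open>c\<close> reveals both edges \<open>{a,c}\<close> and \<open>{b,c}\<close>, so given the revealed edges
  the edge \<open>{a,b}\<close> is nearly uncorrelated with their product. Hence the expected triangle
  count is nearly that of independent edges with the random densities \<open>p\<^sub>e\<close>, while the
  entropy is at most that of those edges, up to the revealed bits. So \<open>ln Z\<^sub>n\<close> is at most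
  the maximum of the mean-field functional \<open>H(p) - (\<Sum>e. I(p\<^sub>e))\<close> up to \<open>o(n\<^sup>2)\<close>.

  \<^emph>\<open>Mean field reduces to a scalar.\<close> For \<open>\<alpha> \<ge> 0\<close>, the inequality of arithmetic and geometric means
  \<open>pqr \<le> (p\<^sup>3 + q\<^sup>3 + r\<^sup>3)/3\<close> decouples the edges at once. For \<open>-2 \<le> \<alpha> \<le> 0\<close> the
  functional lies below its value at the constant mean density: each triangle loses at
  most the squared deviations of its three edges from the mean, and this is
  paid for by the strong convexity \<open>I'' \<ge> 4\<close> of the entropy. This is where \<open>-2\<close> comes from.

  \<^emph>\<open>Concentration.\<close> Changing \<open>h\<close> to \<open>h + t\<close> tilts the measure by \<open>exp(t S\<^sub>n)\<close>. When the maximizer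
  \<open>u\<close> is unique, \<open>m\<close> has derivative \<open>u/2\<close> in \<open>h\<close>, so Chernoff's inequality bounds the probability of a
  deviation of \<open>2S\<^sub>n/n\<^sup>2\<close> from \<open>u\<close> by \<open>exp(-c n\<^sup>2)\<close>. These bounds concern each \<open>S\<^sub>n\<close> separately and are
  summable, so the Borel-Cantelli lemma gives almost sure convergence under every coupling.

  \<^emph>\<open>Uniqueness.\<close> A maximizer \<open>u\<close> is interior, with \<open>\<alpha>u\<^sup>2 - ln(u/(1-u)) = -h\<close>. The left-hand side is
  strictly decreasing in \<open>u\<close> for \<open>\<alpha> \<le> 27/8\<close>, since \<open>u\<^sup>2(1-u) \<le> 4/27\<close>. For larger \<open>\<alpha>\<close>, two maximizers
  must lie on either side of \<open>2/3\<close>; as maximizers increase with \<open>h\<close>, this happens for one \<open>h\<close> at most,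
  and comparison with \<open>\<alpha> = 27/8\<close> at the smaller of them shows that this \<open>h\<close> lies below \<open>ln 2 - 3/2\<close>.
\<close>

section \<open>The scalar variational problem\<close>

lemma continuous_on_xlnx: "continuous_on {0..} (\<lambda>u::real. u * ln u)"
proof -
  have "((\<lambda>u::real. u * ln u) \<longlongrightarrow> 0) (at_right 0)"
    by real_asymp
  then have "continuous (at x within {0..}) (\<lambda>u::real. u * ln u)" if "x \<ge> 0" for x
  proof (cases "x = 0")
    case True
    have "((\<lambda>u::real. u * ln u) \<longlongrightarrow> 0) (at 0 within {0..})"
      using \<open>(_ \<longlongrightarrow> 0) (at_right 0)\<close> by (simp add: at_within_Ici_at_right)
    then show ?thesis using True by (simp add: continuous_within)
  next
    case False
    then have "isCont (\<lambda>u::real. u * ln u) x"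
      using that by (intro continuous_intros) auto
    then show ?thesis by (rule continuous_at_imp_continuous_at_within)
  qed
  then show ?thesis by (simp add: continuous_on_eq_continuous_within)
qed

lemma continuous_on_entropy_fun: "continuous_on {0..1} entropy_fun"
proof -
  have "continuous_on {0..1} (\<lambda>u::real. u * ln u + (1 - u) * ln (1 - u))"
    by (intro continuous_on_add continuous_on_subset[OF continuous_on_xlnx]
        continuous_on_compose2[OF continuous_on_xlnx]) (auto intro!: continuous_intros)
  then show ?thesis by (simp add: entropy_fun_def[abs_def])
qed

lemma continuous_on_scalar_fun: "continuous_on {0..1} (scalar_fun \<alpha> h)"
  unfolding scalar_fun_def[abs_def]
  by (intro continuous_intros continuous_on_entropy_fun) auto

lemma DERIV_entropy_fun:
  assumes "0 < u" "u < 1"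
  shows "(entropy_fun has_real_derivative ln u - ln (1 - u)) (at u)"
proof -
  have "(entropy_fun has_real_derivative
      (1 * ln u + 1 / u * u) + ((0 - 1) * ln (1 - u) + (0 - 1) / (1 - u) * (1 - u))) (at u)"
    unfolding entropy_fun_def[abs_def] using assms
    by (auto intro!: derivative_eq_intros)
  then show ?thesis using assms by simp
qed

text \<open>Twice the derivative of the scalar functional, without the field \<open>h\<close>.\<close>

definition slope :: "real \<Rightarrow> real \<Rightarrow> real" where
  "slope \<alpha> u = \<alpha> * u\<^sup>2 - ln u + ln (1 - u)"

lemma DERIV_scalar_fun:
  assumes "0 < u" "u < 1"
  shows "(scalar_fun \<alpha> h has_real_derivative (slope \<alpha> u + h) / 2) (at u)"
  unfolding scalar_fun_def[abs_def] using assms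
  by (auto intro!: derivative_eq_intros DERIV_entropy_fun simp: slope_def field_simps)

lemma DERIV_slope:
  assumes "0 < u" "u < 1"
  shows "(slope \<alpha> has_real_derivative (2 * \<alpha> * (u\<^sup>2 * (1 - u)) - 1) / (u * (1 - u))) (at u)"
  unfolding slope_def[abs_def] using assms
  by (auto intro!: derivative_eq_intros simp: field_simps power2_eq_square)

lemma maximizers_iff:
  "u \<in> maximizers \<alpha> h \<longleftrightarrow>
     0 \<le> u \<and> u \<le> 1 \<and> (\<forall>v. 0 \<le> v \<longrightarrow> v \<le> 1 \<longrightarrow> scalar_fun \<alpha> h v \<le> scalar_fun \<alpha> h u)"
  by (auto simp: maximizers_def is_arg_max_linorder)

lemma maximizers_nonempty: "\<exists>u. u \<in> maximizers \<alpha> h"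
  using continuous_attains_sup[OF _ _ continuous_on_scalar_fun[of \<alpha> h]]
  by (auto simp: maximizers_iff)

text \<open>The entropy has infinite slope at both endpoints, so moving inside by \<open>w = exp(-(\<bar>\<alpha>\<bar> + \<bar>h\<bar> + 1))\<close> gains
\<open>- w ln w / 2 = (\<bar>\<alpha>\<bar> + \<bar>h\<bar> + 1) w / 2\<close>, which exceeds any loss in the polynomial part.\<close>

lemma maximizer_interior:
  assumes "u \<in> maximizers \<alpha> h"
  shows "0 < u" "u < 1"
proof -
  define A where "A = \<bar>\<alpha>\<bar>"
  define B where "B = \<bar>h\<bar>"
  define w where "w = exp (- (A + B + 1))"
  have w: "0 < w" "w < 1" "ln w = - (A + B + 1)"
    by (auto simp: w_def A_def B_def intro: add_nonneg_pos)
  have "(1 - w) * ln (1 - w) \<le> 0"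
    using w mult_nonneg_nonpos[of "1 - w" "ln (1 - w)"] by simp
  then have ent: "entropy_fun w \<le> - (A * w) - B * w - w"
    unfolding entropy_fun_def w(3) by (simp add: algebra_simps)
  have hw: "h * w \<le> B * w" "- (h * w) \<le> B * w"
    using w mult_right_mono[of h B w] mult_right_mono[of "- h" B w] by (auto simp: B_def)
  have cube: "- (\<alpha> * x) \<le> A * y" "\<alpha> * x \<le> A * y" if "0 \<le> x" "x \<le> y" for x y
  proof -
    have "\<bar>\<alpha> * x\<bar> \<le> A * y" using that by (simp add: abs_mult A_def mult_left_mono)
    then show "- (\<alpha> * x) \<le> A * y" "\<alpha> * x \<le> A * y" by linarith+
  qed
  have Aw: "0 \<le> A * w" using w by (simp add: A_def)
  have "w ^ 3 \<le> w" using w power_decreasing[of 1 3 w] by simp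
  then have "- (\<alpha> * w ^ 3) \<le> A * w" using w by (intro cube) auto
  moreover have "scalar_fun \<alpha> h w - scalar_fun \<alpha> h 0 = \<alpha> * w ^ 3 / 6 + h * w / 2 - entropy_fun w / 2"
    by (simp add: scalar_fun_def entropy_fun_def[of 0])
  ultimately have "scalar_fun \<alpha> h 0 < scalar_fun \<alpha> h w"
    using ent hw w(1) Aw by linarith
  moreover have "scalar_fun \<alpha> h w \<le> scalar_fun \<alpha> h u" "0 \<le> u"
    using assms w by (auto simp: maximizers_iff)
  ultimately show "0 < u" by (cases "u = 0") auto
  have "0 \<le> 1 - (1 - w) ^ 3" "1 - (1 - w) ^ 3 \<le> 3 * w"
    using w Bernoulli_inequality[of "- w" 3] by (simp_all add: power_le_one)
  then have "\<alpha> * (1 - (1 - w) ^ 3) \<le> A * (3 * w)" by (rule cube(2))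
  moreover have "scalar_fun \<alpha> h (1 - w) - scalar_fun \<alpha> h 1 =
      - (\<alpha> * (1 - (1 - w) ^ 3)) / 6 - h * w / 2 - entropy_fun w / 2"
    by (simp add: scalar_fun_def entropy_fun_def field_simps)
  ultimately have "scalar_fun \<alpha> h 1 < scalar_fun \<alpha> h (1 - w)"
    using ent hw w(1) Aw by linarith
  moreover have "scalar_fun \<alpha> h (1 - w) \<le> scalar_fun \<alpha> h u" "u \<le> 1"
    using assms w by (auto simp: maximizers_iff)
  ultimately show "u < 1" by (cases "u = 1") auto
qed

lemma maximizer_slope:
  assumes "u \<in> maximizers \<alpha> h"
  shows "slope \<alpha> u = - h"
proof -
  note u = maximizer_interior[OF assms]
  have "(slope \<alpha> u + h) / 2 = 0"
    using DERIV_scalar_fun[OF u, of \<alpha> h]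
  proof (rule DERIV_local_max)
    show "0 < min u (1 - u)" using u by simp
    show "\<forall>y. \<bar>u - y\<bar> < min u (1 - u) \<longrightarrow> scalar_fun \<alpha> h y \<le> scalar_fun \<alpha> h u"
      using assms by (auto simp: maximizers_iff)
  qed
  then show ?thesis by simp
qed

lemma sq_mult_compl_strict_mono:
  assumes "0 \<le> u" "u < v" "v \<le> (2/3 :: real)"
  shows "u\<^sup>2 * (1 - u) < v\<^sup>2 * (1 - v)"
proof -
  have "v\<^sup>2 * (1 - v) - u\<^sup>2 * (1 - u) = (v - u) * (u * (1 - u - v) + v * (1 - v))"
    by (simp add: algebra_simps power2_eq_square power3_eq_cube)
  moreover have "u * (1 - u - v) + v * (1 - v) > 0"
  proof -
    have "u * (1 - u - v) \<ge> u * (- 1/3)" using assms by (intro mult_left_mono) auto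
    moreover have "v * (1 - v) \<ge> v * (1/3)" using assms by (intro mult_left_mono) auto
    ultimately show ?thesis using assms by linarith
  qed
  ultimately show ?thesis using assms by (smt (verit) mult_pos_pos)
qed

lemma sq_mult_compl_strict_antimono:
  assumes "2/3 \<le> u" "u < v" "v \<le> (1 :: real)"
  shows "v\<^sup>2 * (1 - v) < u\<^sup>2 * (1 - u)"
proof -
  have "u\<^sup>2 * (1 - u) - v\<^sup>2 * (1 - v) = (v - u) * (u * (u + v - 1) - v * (1 - v))"
    by (simp add: algebra_simps power2_eq_square power3_eq_cube)
  moreover have "u * (u + v - 1) - v * (1 - v) > 0"
  proof -
    have "u * (u + v - 1) - v * (1 - v) =
        (u - 2/3) + (v - 2/3) + (u - 2/3)\<^sup>2 + (v - 2/3)\<^sup>2 + (u - 2/3) * (v - 2/3)"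
      by (simp add: algebra_simps power2_eq_square)
    moreover have "(u - 2/3) * (v - 2/3) \<ge> 0" using assms by simp
    ultimately show ?thesis using assms by (smt (verit) zero_le_power2)
  qed
  ultimately show ?thesis using assms by (smt (verit) mult_pos_pos)
qed

text \<open>At \<open>\<alpha> = 27/8\<close> the derivative of the slope has the sign of \<open>(27/4) u\<^sup>2(1-u) - 1\<close>, which vanishes
only at the maximum point \<open>u = 2/3\<close> of \<open>u\<^sup>2(1-u)\<close>; strict monotonicity survives this single zero.\<close>

lemma slope_alpha_c_decreasing:
  assumes "0 < u" "u < v" "v < 1"
  shows "slope alpha_c v < slope alpha_c u"
proof -
  have *: "slope alpha_c v < slope alpha_c u"
    if uv: "0 < u" "u < v" "v < 1" "v \<le> 2/3 \<or> 2/3 \<le> u" for u v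
  proof (rule DERIV_neg_imp_decreasing_open[OF uv(2)])
    fix x assume x: "u < x" "x < v"
    have "x\<^sup>2 * (1 - x) < 4 / 27"
      using sq_mult_compl_strict_mono[of x "2/3"] sq_mult_compl_strict_antimono[of "2/3" x] uv x
      by (auto simp: power2_eq_square)
    then have "(2 * alpha_c * (x\<^sup>2 * (1 - x)) - 1) / (x * (1 - x)) < 0"
      using uv x by (intro divide_neg_pos) (auto simp: alpha_c_def)
    then show "\<exists>y. (slope alpha_c has_real_derivative y) (at x) \<and> y < 0"
      using DERIV_slope[of x alpha_c] uv x by auto
  next
    show "continuous_on {u..v} (slope alpha_c)"
      using uv by (intro DERIV_continuous_on[OF has_field_derivative_at_within[OF DERIV_slope]]) auto
  qed
  show ?thesis
  proof (cases "v \<le> 2/3 \<or> 2/3 \<le> u")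
    case True
    then show ?thesis using * assms by blast
  next
    case False
    then show ?thesis using *[of u "2/3"] *[of "2/3" v] assms by auto
  qed
qed

lemma slope_shift: "slope \<alpha> u = slope \<beta> u + (\<alpha> - \<beta>) * u\<^sup>2"
  by (simp add: slope_def algebra_simps)

text \<open>Lowering \<open>\<alpha>\<close> below its critical value only makes the slope decrease faster, because of the
term \<open>\<alpha>u\<^sup>2\<close>; so the slope takes the value \<open>-h\<close> once.\<close>

lemma maximizers_unique_subcritical:
  assumes "\<alpha> \<le> alpha_c" "u \<in> maximizers \<alpha> h" "v \<in> maximizers \<alpha> h"
  shows "u = v"
proof -
  have False if uv: "u < v" "u \<in> maximizers \<alpha> h" "v \<in> maximizers \<alpha> h" for u v
  proof -
    note i = maximizer_interior[OF uv(2)] maximizer_interior[OF uv(3)]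
    have "slope \<alpha> u = slope \<alpha> v" using maximizer_slope uv by metis
    moreover have "(alpha_c - \<alpha>) * u\<^sup>2 \<le> (alpha_c - \<alpha>) * v\<^sup>2"
      using assms(1) uv i by (intro mult_left_mono power_mono) auto
    ultimately show False
      using slope_alpha_c_decreasing[of u v] uv i
      by (simp add: slope_shift[of \<alpha> _ alpha_c] algebra_simps)
  qed
  then show ?thesis using assms by (metis linorder_neqE)
qed

lemma slope_increasing:
  assumes "0 < u" "u < v" "v < 1" "\<And>x. u < x \<Longrightarrow> x < v \<Longrightarrow> 2 * \<alpha> * (x\<^sup>2 * (1 - x)) > 1"
  shows "slope \<alpha> u < slope \<alpha> v"
proof (rule DERIV_pos_imp_increasing_open[OF assms(2)])
  fix x assume "u < x" "x < v"
  then have "(2 * \<alpha> * (x\<^sup>2 * (1 - x)) - 1) / (x * (1 - x)) > 0"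
    using assms by (intro divide_pos_pos) auto
  then show "\<exists>y. (slope \<alpha> has_real_derivative y) (at x) \<and> 0 < y"
    using DERIV_slope[of x \<alpha>] assms \<open>u < x\<close> \<open>x < v\<close> by auto
next
  show "continuous_on {u..v} (slope \<alpha>)"
    using assms by (intro DERIV_continuous_on[OF has_field_derivative_at_within[OF DERIV_slope]]) auto
qed

text \<open>Where the slope increases the functional is strictly convex, and a critical point at the end of
an interval of strict convexity is a strict minimum of that interval.\<close>

lemma not_maximizer_at_increase:
  assumes "0 < u" "u < v" "v < 1" "\<And>x. u < x \<Longrightarrow> x < v \<Longrightarrow> 2 * \<alpha> * (x\<^sup>2 * (1 - x)) > 1"
  shows "u \<notin> maximizers \<alpha> h" "v \<notin> maximizers \<alpha> h"
proof -
  have cont: "continuous_on {u..v} (scalar_fun \<alpha> h)"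
    by (rule continuous_on_subset[OF continuous_on_scalar_fun]) (use assms in auto)
  show "u \<notin> maximizers \<alpha> h"
  proof
    assume u: "u \<in> maximizers \<alpha> h"
    have "scalar_fun \<alpha> h u < scalar_fun \<alpha> h v"
    proof (rule DERIV_pos_imp_increasing_open[OF assms(2) _ cont])
      fix x assume x: "u < x" "x < v"
      have "slope \<alpha> u < slope \<alpha> x" using assms x by (intro slope_increasing) auto
      then show "\<exists>y. (scalar_fun \<alpha> h has_real_derivative y) (at x) \<and> 0 < y"
        using DERIV_scalar_fun[of x \<alpha> h] maximizer_slope[OF u] assms x by force
    qed
    moreover have "scalar_fun \<alpha> h v \<le> scalar_fun \<alpha> h u"
      using u assms by (simp add: maximizers_iff)
    ultimately show False by simp
  qed
  show "v \<notin> maximizers \<alpha> h"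
  proof
    assume v: "v \<in> maximizers \<alpha> h"
    have "scalar_fun \<alpha> h v < scalar_fun \<alpha> h u"
    proof (rule DERIV_neg_imp_decreasing_open[OF assms(2) _ cont])
      fix x assume x: "u < x" "x < v"
      have "slope \<alpha> x < slope \<alpha> v" using assms x by (intro slope_increasing) auto
      then have "(slope \<alpha> x + h) / 2 < 0" using maximizer_slope[OF v] by simp
      then show "\<exists>y. (scalar_fun \<alpha> h has_real_derivative y) (at x) \<and> y < 0"
        using DERIV_scalar_fun[of x \<alpha> h] assms x by force
    qed
    moreover have "scalar_fun \<alpha> h u \<le> scalar_fun \<alpha> h v"
      using v assms by (simp add: maximizers_iff)
    ultimately show False by simp
  qed
qed

text \<open>By Rolle's theorem the slope has a critical point \<open>c\<close> between two maximizers, that is,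
\<open>2\<alpha> c\<^sup>2(1-c) = 1\<close>. Since \<open>x\<^sup>2(1-x)\<close> increases up to \<open>2/3\<close> and decreases afterwards, two maximizers on the
same side of \<open>2/3\<close> would put one of them at the end of an interval on which the slope increases.\<close>

lemma two_maximizers_straddle:
  assumes "alpha_c < \<alpha>" "u < v" "u \<in> maximizers \<alpha> h" "v \<in> maximizers \<alpha> h"
  shows "u < 2/3" "2/3 < v"
proof -
  note i = maximizer_interior[OF assms(3)] maximizer_interior[OF assms(4)]
  have a: "\<alpha> > 0" using assms(1) by (simp add: alpha_c_def)
  have diff: "slope \<alpha> differentiable (at x)" if "u < x" "x < v" for x
    using DERIV_slope[of x \<alpha>] that i by (auto simp: real_differentiable_def)
  have "continuous_on {u..v} (slope \<alpha>)"
    using i by (intro DERIV_continuous_on[OF has_field_derivative_at_within[OF DERIV_slope]]) auto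
  with assms(2) diff obtain c where c: "u < c" "c < v" "(slope \<alpha> has_real_derivative 0) (at c)"
    using Rolle[of u v "slope \<alpha>"] maximizer_slope[OF assms(3)] maximizer_slope[OF assms(4)] by auto
  then have "(2 * \<alpha> * (c\<^sup>2 * (1 - c)) - 1) / (c * (1 - c)) = 0"
    using DERIV_slope[of c \<alpha>] i DERIV_unique by fastforce
  then have c1: "2 * \<alpha> * (c\<^sup>2 * (1 - c)) = 1" using c i by auto
  have gt: "2 * \<alpha> * (x\<^sup>2 * (1 - x)) > 1" if "c\<^sup>2 * (1 - c) < x\<^sup>2 * (1 - x)" for x
    using mult_strict_left_mono[OF that, of "2 * \<alpha>"] a c1 by simp
  have "v > 2/3"
  proof (rule ccontr)
    assume "\<not> v > 2/3"
    then have "v \<notin> maximizers \<alpha> h"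
      using c i by (intro not_maximizer_at_increase(2)[of c v]) (auto intro!: gt sq_mult_compl_strict_mono)
    then show False using assms by simp
  qed
  moreover have "u < 2/3"
  proof (rule ccontr)
    assume "\<not> u < 2/3"
    then have "u \<notin> maximizers \<alpha> h"
      using c i by (intro not_maximizer_at_increase(1)[of u c]) (auto intro!: gt sq_mult_compl_strict_antimono)
    then show False using assms by simp
  qed
  ultimately show "u < 2/3" "2/3 < v" by auto
qed

lemma maximizers_mono:
  assumes "h < h'" "u \<in> maximizers \<alpha> h" "v \<in> maximizers \<alpha> h'"
  shows "u \<le> v"
proof -
  have "scalar_fun \<alpha> h v \<le> scalar_fun \<alpha> h u" "scalar_fun \<alpha> h' u \<le> scalar_fun \<alpha> h' v"
    using assms by (auto simp: maximizers_iff)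
  then have "(h' - h) * u \<le> (h' - h) * v"
    by (simp add: scalar_fun_def algebra_simps)
  then show ?thesis using assms(1) by simp
qed

text \<open>Maximizers increase with the field. If two fields both had two maximizers, then the upper
maximizer for the smaller field, above \<open>2/3\<close>, would not exceed the lower maximizer for the larger field,
below \<open>2/3\<close>.\<close>

lemma coexistence_field_unique:
  assumes "alpha_c < \<alpha>" "u < v" "u \<in> maximizers \<alpha> h" "v \<in> maximizers \<alpha> h"
    "u' < v'" "u' \<in> maximizers \<alpha> h'" "v' \<in> maximizers \<alpha> h'"
  shows "h = h'"
  using two_maximizers_straddle[OF assms(1-4)] two_maximizers_straddle[OF assms(1,5-7)]
    maximizers_mono[of h h' v \<alpha> u'] maximizers_mono[of h' h v' \<alpha> u] assms
  by (smt (verit))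

lemma card_maximizers_eq_2_iff:
  assumes "alpha_c < \<alpha>"
  shows "card (maximizers \<alpha> h) = 2 \<longleftrightarrow> (\<exists>u v. u < v \<and> u \<in> maximizers \<alpha> h \<and> v \<in> maximizers \<alpha> h)"
proof
  assume "card (maximizers \<alpha> h) = 2"
  then obtain u v where "maximizers \<alpha> h = {u, v}" "u \<noteq> v" by (auto simp: card_2_iff)
  then show "\<exists>u v. u < v \<and> u \<in> maximizers \<alpha> h \<and> v \<in> maximizers \<alpha> h"
    by (metis insertCI linorder_neqE)
next
  assume "\<exists>u v. u < v \<and> u \<in> maximizers \<alpha> h \<and> v \<in> maximizers \<alpha> h"
  then obtain u v where uv: "u < v" "u \<in> maximizers \<alpha> h" "v \<in> maximizers \<alpha> h" by blast
  have "w = u \<or> w = v" if w: "w \<in> maximizers \<alpha> h" for w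
    using two_maximizers_straddle[OF assms _ w uv(2)] two_maximizers_straddle[OF assms _ uv(2) w]
      two_maximizers_straddle[OF assms _ w uv(3)] two_maximizers_straddle[OF assms _ uv(3) w] uv(1)
      two_maximizers_straddle[OF assms uv]
    by (meson linorder_neqE not_less_iff_gr_or_eq)
  then have "maximizers \<alpha> h = {u, v}" using uv by blast
  then show "card (maximizers \<alpha> h) = 2" using uv(1) by simp
qed

text \<open>The lower maximizer \<open>u < 2/3\<close> satisfies \<open>- h = slope \<alpha> u > slope alpha_c u > slope alpha_c (2/3)\<close>,
and the last value is \<open>- h_c\<close>.\<close>

lemma coexistence_field_less_h_c:
  assumes "alpha_c < \<alpha>" "u < v" "u \<in> maximizers \<alpha> h" "v \<in> maximizers \<alpha> h"
  shows "h < h_c"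
proof -
  note u = maximizer_interior[OF assms(3)]
  have "slope alpha_c (2/3) < slope alpha_c u"
    using two_maximizers_straddle(1)[OF assms] u by (intro slope_alpha_c_decreasing) auto
  moreover have "(\<alpha> - alpha_c) * u\<^sup>2 > 0" using assms(1) u by simp
  ultimately have "slope alpha_c (2/3) < - h"
    using maximizer_slope[OF assms(3)] by (simp add: slope_shift[of \<alpha> _ alpha_c])
  moreover have "slope alpha_c (2/3) = 3/2 - ln 2"
    by (simp add: slope_def alpha_c_def power2_eq_square ln_div)
  ultimately show ?thesis by (simp add: h_c_def)
qed

text \<open>If two maximizers coexisted at \<open>h\<close>, then \<open>h\<close> would be the only such field, hence the value that
defines the critical curve, and it would lie below \<open>h_c\<close>; so \<open>(\<alpha>, h)\<close> would be on that curve.\<close>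

lemma uniqueness_region_maximizers:
  assumes "(\<alpha>, h) \<in> uniqueness_region"
  shows "maximizers \<alpha> h = {u_star \<alpha> h}"
proof -
  have uniq: "u = v" if "u \<in> maximizers \<alpha> h" "v \<in> maximizers \<alpha> h" for u v
  proof (cases "\<alpha> \<le> alpha_c")
    case True
    then show ?thesis using maximizers_unique_subcritical that by blast
  next
    case False
    then have a: "alpha_c < \<alpha>" by simp
    show ?thesis
    proof (rule ccontr)
      assume "u \<noteq> v"
      then obtain u v where uv: "u < v" "u \<in> maximizers \<alpha> h" "v \<in> maximizers \<alpha> h"
        using \<open>u \<in> _\<close> \<open>v \<in> _\<close> by (cases u v rule: linorder_cases) auto
      have "crit_field \<alpha> = h"
        unfolding crit_field_def card_maximizers_eq_2_iff[OF a]
        using uv coexistence_field_unique[OF a] by (intro the_equality) blast+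
      then show False
        using coexistence_field_less_h_c[OF a uv] assms a
        by (auto simp: uniqueness_region_def critical_curve_def)
    qed
  qed
  obtain u where u: "u \<in> maximizers \<alpha> h" using maximizers_nonempty by blast
  then have "maximizers \<alpha> h = {u}" using uniq by blast
  then show ?thesis by (simp add: u_star_def)
qed

section \<open>Sums over edges and triangles\<close>

lemma sum_edges: "(\<Sum>e\<in>edges n. f e) = (\<Sum>b<n. \<Sum>a<b. f {a, b})"
proof -
  have "(\<Sum>e\<in>edges n. f e) = (\<Sum>(b, a)\<in>(SIGMA b:{..<n}. {..<b}). f {a, b})"
  proof (rule sum.reindex_bij_betw[of "\<lambda>(b, a). {a, b}", symmetric, THEN trans])
    show "bij_betw (\<lambda>(b, a). {a, b}) (SIGMA b:{..<n}. {..<b}) (edges n)"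
      unfolding bij_betw_def
    proof
      show "inj_on (\<lambda>(b, a). {a, b}) (SIGMA b:{..<n}. {..<b})"
        by (auto simp: inj_on_def doubleton_eq_iff)
      show "(\<lambda>(b, a). {a, b}) ` (SIGMA b:{..<n}. {..<b}) = edges n"
      proof (intro equalityI subsetI)
        fix e assume "e \<in> edges n"
        then obtain a b where "e = {a, b}" "a \<noteq> b" "a < n" "b < n"
          by (auto simp: edges_def card_2_iff)
        then show "e \<in> (\<lambda>(b, a). {a, b}) ` (SIGMA b:{..<n}. {..<b})"
          by (cases a b rule: linorder_cases) (auto simp: image_iff insert_commute)
      qed (auto simp: edges_def)
    qed
  qed (simp add: case_prod_unfold)
  then show ?thesis by (simp add: sum.Sigma)
qed

lemma prod_triangle:
  assumes "a < b" "b < (c::nat)"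
  shows "(\<Prod>e\<in>{{a, b}, {b, c}, {a, c}}. x e :: real) = x {a, b} * x {b, c} * x {a, c}"
  using assms by (simp add: doubleton_eq_iff)

lemma sum_triangles:
  "(\<Sum>t\<in>triangles n. \<Prod>e\<in>t. x e :: real) =
     (\<Sum>c<n. \<Sum>b<c. \<Sum>a<b. x {a, b} * x {b, c} * x {a, c})"
proof -
  define tri :: "nat \<times> nat \<times> nat \<Rightarrow> nat set set" where
    "tri = (\<lambda>(c, b, a). {{a, b}, {b, c}, {a, c}})"
  define D where "D = (SIGMA c:{..<n}. SIGMA b:{..<c}. {..<b})"
  (* The vertices of a triangle are the union of its edges, so sorted triples parametrize triangles
     injectively. *)
  have U: "\<Union> (tri (c, b, a)) = {a, b, c}" for a b c
    by (auto simp: tri_def)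
  have inj: "inj_on tri D"
  proof (rule inj_onI)
    fix p q assume pq: "p \<in> D" "q \<in> D" "tri p = tri q"
    obtain c b a where p: "p = (c, b, a)" by (cases p) auto
    obtain c' b' a' where q: "q = (c', b', a')" by (cases q) auto
    have "{a, b, c} = {a', b', c'}" using pq(3) U unfolding p q by metis
    moreover have "a < b" "b < c" "a' < b'" "b' < c'" using pq by (auto simp: p q D_def)
    moreover have "sorted_list_of_set {x, y, z} = [x, y, z]" if "x < y" "y < z" for x y z :: nat
      using that by auto
    ultimately have "[a, b, c] = [a', b', c']" by metis
    then show "p = q" by (simp add: p q)
  qed
  have img: "tri ` D = triangles n"
  proof -
    have "triangles n \<subseteq> tri ` D"
    proof
      fix t assume "t \<in> triangles n"
      then obtain a b c where "t = {{a, b}, {b, c}, {a, c}}" "a < b" "b < c" "c < n"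
        by (auto simp: triangles_def)
      then have "t = tri (c, b, a)" "(c, b, a) \<in> D" by (auto simp: tri_def D_def)
      then show "t \<in> tri ` D" by blast
    qed
    then show ?thesis by (auto simp: triangles_def tri_def D_def)
  qed
  have "(\<Sum>t\<in>triangles n. \<Prod>e\<in>t. x e) = (\<Sum>p\<in>D. \<Prod>e\<in>tri p. x e)"
    unfolding img[symmetric] by (simp add: sum.reindex[OF inj])
  also have "\<dots> = (\<Sum>(c, b, a)\<in>D. x {a, b} * x {b, c} * x {a, c})"
    by (rule sum.cong) (auto simp: D_def tri_def prod_triangle)
  also have "\<dots> = (\<Sum>c<n. \<Sum>b<c. \<Sum>a<b. x {a, b} * x {b, c} * x {a, c})"
    unfolding D_def by (simp add: sum.Sigma split_def)
  finally show ?thesis .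
qed

lemma sum_pairs_endpoints:
  "(\<Sum>b<n. \<Sum>a<b. g a + g b) = (real n - 1) * (\<Sum>a<n. g a :: real)"
  by (induction n) (auto simp: sum.distrib algebra_simps)

text \<open>Double counting: every edge lies in \<open>n - 2\<close> triangles.\<close>

lemma sum_triples_pairs:
  "(\<Sum>c<n. \<Sum>b<c. \<Sum>a<b. f {a, b} + f {b, c} + f {a, c}) =
     (real n - 2) * (\<Sum>e\<in>edges n. f e :: real)"
proof (induction n)
  case 0
  then show ?case by (simp add: sum_edges)
next
  case (Suc n)
  have "(\<Sum>b<n. \<Sum>a<b. f {a, b} + f {b, n} + f {a, n}) =
      (\<Sum>e\<in>edges n. f e) + (\<Sum>b<n. \<Sum>a<b. f {a, n} + f {b, n})"
    by (simp add: sum_edges sum.distrib algebra_simps)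
  also have "\<dots> = (\<Sum>e\<in>edges n. f e) + (real n - 1) * (\<Sum>a<n. f {a, n})"
    by (simp only: sum_pairs_endpoints)
  finally show ?case
    using Suc.IH by (simp add: sum_edges algebra_simps)
qed

lemma real_card_edges: "real (card (edges n)) = real n * (real n - 1) / 2"
proof -
  have "(\<Sum>e\<in>edges n. 1::real) = (\<Sum>b<n. real b)"
    by (subst sum_edges) simp
  also have "\<dots> = real n * (real n - 1) / 2"
    by (induction n) (auto simp: field_simps)
  finally show ?thesis by simp
qed

lemma edge_memI: "a < b \<Longrightarrow> b < n \<Longrightarrow> {a, b} \<in> edges n"
  by (auto simp: edges_def)

section \<open>The mean-field functional\<close>

text \<open>The functional of the Gibbs variational principle at independent edges with probabilities \<open>p e\<close>:
expected Hamiltonian plus entropy.\<close>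

definition mean_field :: "real \<Rightarrow> real \<Rightarrow> nat \<Rightarrow> (nat set \<Rightarrow> real) \<Rightarrow> real" where
  "mean_field \<alpha> h n p = hamiltonian \<alpha> h n p - (\<Sum>e\<in>edges n. entropy_fun (p e))"

text \<open>The cubic correction comes from the \<open>n - 2\<close> triangles at an edge, where the scalar functional counts \<open>n\<close>.\<close>

lemma mean_field_const:
  assumes "n > 0"
  shows "mean_field \<alpha> h n (\<lambda>_. u) =
    real n * (real n - 1) * (scalar_fun \<alpha> h u - \<alpha> * u ^ 3 / (3 * real n))"
proof -
  have T: "(\<Sum>c<n. \<Sum>b<c. \<Sum>a<b. u ^ 3) = (real n - 2) / 3 * (\<Sum>e\<in>edges n. u ^ 3)"
    using sum_triples_pairs[of "\<lambda>_. u ^ 3 / 3" n] by (simp add: field_simps)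
  have "mean_field \<alpha> h n (\<lambda>_. u) =
      \<alpha> / real n * ((real n - 2) / 3 * (\<Sum>e\<in>edges n. u ^ 3)) +
      h * (\<Sum>e\<in>edges n. u) - (\<Sum>e\<in>edges n. entropy_fun u)"
    unfolding mean_field_def hamiltonian_def sum_triangles T[symmetric]
    by (simp add: power3_eq_cube mult.assoc)
  also have "\<dots> = real n * (real n - 1) * (scalar_fun \<alpha> h u - \<alpha> * u ^ 3 / (3 * real n))"
    using assms by (simp add: real_card_edges scalar_fun_def field_simps)
  finally show ?thesis .
qed

lemma am_gm_3:
  assumes "0 \<le> (a::real)" "0 \<le> b" "0 \<le> c"
  shows "a * b * c \<le> a ^ 3 / 3 + b ^ 3 / 3 + c ^ 3 / 3"
proof -
  have "a ^ 3 + b ^ 3 + c ^ 3 - 3 * (a * b * c) =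
      (a + b + c) * ((a - b)\<^sup>2 + (b - c)\<^sup>2 + (a - c)\<^sup>2) / 2"
    by (simp add: power2_eq_square power3_eq_cube algebra_simps)
  moreover have "\<dots> \<ge> 0" using assms by simp
  ultimately show ?thesis by simp
qed

text \<open>The inequality between arithmetic and geometric means replaces the product over a triangle by a
sum over its edges; the functional then splits into one scalar functional per edge.\<close>

lemma mean_field_le_attractive:
  assumes "\<alpha> \<ge> 0" "\<And>e. e \<in> edges n \<Longrightarrow> 0 \<le> p e \<and> p e \<le> 1"
    and m: "\<And>v. 0 \<le> v \<Longrightarrow> v \<le> 1 \<Longrightarrow> scalar_fun \<alpha> h v \<le> m"
  shows "mean_field \<alpha> h n p \<le> real n * (real n - 1) * m"
proof (cases "n = 0")
  case True
  then show ?thesis by (simp add: mean_field_def hamiltonian_def sum_triangles sum_edges)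
next
  case False
  have "(\<Sum>t\<in>triangles n. \<Prod>e\<in>t. p e) \<le>
      (\<Sum>c<n. \<Sum>b<c. \<Sum>a<b. p {a, b} ^ 3 / 3 + p {b, c} ^ 3 / 3 + p {a, c} ^ 3 / 3)"
    unfolding sum_triangles by (intro sum_mono am_gm_3 assms(2)[THEN conjunct1] edge_memI) auto
  also have "\<dots> = (real n - 2) * (\<Sum>e\<in>edges n. p e ^ 3 / 3)"
    by (rule sum_triples_pairs)
  also have "\<dots> \<le> real n * (\<Sum>e\<in>edges n. p e ^ 3 / 3)"
    using assms(2) by (intro mult_right_mono sum_nonneg) auto
  finally have "\<alpha> / real n * (\<Sum>t\<in>triangles n. \<Prod>e\<in>t. p e) \<le>
      \<alpha> / real n * (real n * (\<Sum>e\<in>edges n. p e ^ 3 / 3))"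
    using assms(1) by (intro mult_left_mono) auto
  then have "mean_field \<alpha> h n p \<le>
      \<alpha> * (\<Sum>e\<in>edges n. p e ^ 3 / 3) + h * (\<Sum>e\<in>edges n. p e) - (\<Sum>e\<in>edges n. entropy_fun (p e))"
    using False by (simp add: mean_field_def hamiltonian_def)
  also have "\<dots> = (\<Sum>e\<in>edges n. 2 * scalar_fun \<alpha> h (p e))"
    by (simp add: scalar_fun_def sum_distrib_left sum.distrib sum_subtractf algebra_simps)
  also have "\<dots> \<le> (\<Sum>e\<in>edges n. 2 * m)"
    using assms(2) by (intro sum_mono mult_left_mono m) auto
  also have "\<dots> = real n * (real n - 1) * m"
    by (simp add: real_card_edges)
  finally show ?thesis .
qed

text \<open>With \<open>a\<close>, \<open>b\<close>, \<open>c\<close> the deviations of \<open>x\<close>, \<open>y\<close>, \<open>z\<close> from \<open>u\<close>, the remainder after the linear part is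
\<open>z ab + u ac + u bc\<close>. Grouping the cubic term with the first product keeps all three coefficients
in \<open>[0,1]\<close>, so each summand is at least minus half the sum of two squares.\<close>

lemma prod3_ge_tangent:
  assumes "0 \<le> (u::real)" "u \<le> 1" "0 \<le> z" "z \<le> 1"
  shows "u ^ 3 + u\<^sup>2 * ((x - u) + (y - u) + (z - u)) - ((x - u)\<^sup>2 + (y - u)\<^sup>2 + (z - u)\<^sup>2) \<le> x * y * z"
proof -
  have *: "- ((a\<^sup>2 + b\<^sup>2) / 2) \<le> c * (a * b)" if "0 \<le> c" "c \<le> 1" for a b c :: real
  proof -
    have "\<bar>a * b\<bar> \<le> (a\<^sup>2 + b\<^sup>2) / 2"
      using sum_squares_bound[of "\<bar>a\<bar>" "\<bar>b\<bar>"] by (simp add: abs_mult)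
    then have "\<bar>c * (a * b)\<bar> \<le> 1 * ((a\<^sup>2 + b\<^sup>2) / 2)"
      unfolding abs_mult[of c] using that by (intro mult_mono) auto
    then have "- (c * (a * b)) \<le> (a\<^sup>2 + b\<^sup>2) / 2" using abs_le_D2 by fastforce
    then show ?thesis by (subst minus_le_iff)
  qed
  define a b c where "a = x - u" and "b = y - u" and "c = z - u"
  have "x * y * z = u ^ 3 + u\<^sup>2 * (a + b + c) + (z * (a * b) + u * (a * c) + u * (b * c))"
    by (simp add: a_def b_def c_def algebra_simps power2_eq_square power3_eq_cube)
  moreover have "- (a\<^sup>2 + b\<^sup>2 + c\<^sup>2) \<le> z * (a * b) + u * (a * c) + u * (b * c)"
    using *[OF assms(3,4), of a b] *[OF assms(1,2), of a c] *[OF assms(1,2), of b c] by (simp add: field_simps)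
  ultimately show ?thesis unfolding a_def b_def c_def by linarith
qed

text \<open>The derivative of the logit is \<open>1/(x(1-x)) \<ge> 4\<close>.\<close>

lemma logit_growth:
  fixes u v :: real
  assumes "0 < u" "u \<le> v" "v < 1"
  shows "ln u - ln (1 - u) + 4 * (v - u) \<le> ln v - ln (1 - v)"
proof -
  have "ln u - ln (1 - u) - 4 * u \<le> ln v - ln (1 - v) - 4 * v"
  proof (rule DERIV_nonneg_imp_nondecreasing[OF assms(2)])
    fix x assume "u \<le> x" "x \<le> v"
    then have x: "0 < x" "x < 1" using assms by auto
    have "((\<lambda>x. ln x - ln (1 - x) - 4 * x) has_real_derivative 1 / x + 1 / (1 - x) - 4) (at x)"
      using x by (auto intro!: derivative_eq_intros)
    moreover have "1 / x + 1 / (1 - x) - 4 = (1 - 2 * x)\<^sup>2 / (x * (1 - x))"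
      using x by (simp add: field_simps power2_eq_square)
    moreover have "\<dots> \<ge> 0" using x by simp
    ultimately show "\<exists>y. ((\<lambda>x. ln x - ln (1 - x) - 4 * x) has_real_derivative y) (at x) \<and> 0 \<le> y"
      by metis
  qed
  then show ?thesis by simp
qed

text \<open>Strong convexity of the entropy, from \<open>I'' \<ge> 4\<close>; equivalently, Pinsker's inequality for two
Bernoulli laws. Allowing \<open>p\<close> to be an endpoint matters, since conditional edge probabilities may be 0 or 1.\<close>

lemma entropy_fun_ge_tangent:
  assumes u: "0 < u" "u < 1" and p: "0 \<le> p" "p \<le> 1"
  shows "entropy_fun u + (ln u - ln (1 - u)) * (p - u) + 2 * (p - u)\<^sup>2 \<le> entropy_fun p"
proof -
  define f where "f x = entropy_fun x - (ln u - ln (1 - u)) * (x - u) - 2 * (x - u)\<^sup>2" for x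
  have cont: "continuous_on {0..1} f"
    unfolding f_def[abs_def] by (intro continuous_intros continuous_on_entropy_fun)
  have der: "(f has_real_derivative (ln x - ln (1 - x)) - (ln u - ln (1 - u)) - 4 * (x - u)) (at x)"
    if "0 < x" "x < 1" for x
    unfolding f_def[abs_def] using that
    by (auto intro!: derivative_eq_intros DERIV_entropy_fun)
  have "f u \<le> f p"
  proof (cases p u rule: linorder_cases)
    case less
    show ?thesis
    proof (rule DERIV_nonpos_imp_decreasing_open[where a = p and b = u and f = f])
      show "p \<le> u" using less by simp
      show "continuous_on {p..u} f" using p u by (intro continuous_on_subset[OF cont]) auto
      fix x assume x: "p < x" "x < u"
      then show "\<exists>y. (f has_real_derivative y) (at x) \<and> y \<le> 0"
        using der[of x] logit_growth[of x u] p u by force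
    qed
  next
    case greater
    show ?thesis
    proof (rule DERIV_nonneg_imp_increasing_open[where a = u and b = p and f = f])
      show "u \<le> p" using greater by simp
      show "continuous_on {u..p} f" using p u by (intro continuous_on_subset[OF cont]) auto
      fix x assume x: "u < x" "x < p"
      then show "\<exists>y. (f has_real_derivative y) (at x) \<and> 0 \<le> y"
        using der[of x] logit_growth[of u x] p u by force
    qed
  qed simp
  then show ?thesis by (simp add: f_def)
qed

lemma mean_field_cong:
  assumes "\<And>e. e \<in> edges n \<Longrightarrow> p e = q e"
  shows "mean_field \<alpha> h n p = mean_field \<alpha> h n q"
proof -
  have "(\<Sum>t\<in>triangles n. \<Prod>e\<in>t. p e) = (\<Sum>t\<in>triangles n. \<Prod>e\<in>t. q e)"
    unfolding sum_triangles
    by (intro sum.cong refl arg_cong2[where f = "(*)"] assms edge_memI) auto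
  then show ?thesis
    using assms by (simp add: mean_field_def hamiltonian_def)
qed

text \<open>The constant is the mean \<open>u\<close> of \<open>p\<close>, so the terms linear in the deviations cancel. With \<open>Q\<close> the sum of
the squared deviations, the triangles contribute at most \<open>\<bar>\<alpha>\<bar> (n-2)/n Q \<le> 2 Q\<close>, and the entropy costs \<open>2 Q\<close>.\<close>

lemma mean_field_le_repulsive:
  assumes \<alpha>: "- 2 \<le> \<alpha>" "\<alpha> \<le> 0" and n: "n \<ge> 2"
    and p: "\<And>e. e \<in> edges n \<Longrightarrow> 0 \<le> p e \<and> p e \<le> 1"
  shows "\<exists>u. 0 \<le> u \<and> u \<le> 1 \<and> mean_field \<alpha> h n p \<le> mean_field \<alpha> h n (\<lambda>_. u)"
proof -
  define N where "N = real (card (edges n))"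
  have N: "N > 0" using n by (simp add: N_def real_card_edges)
  define u where "u = (\<Sum>e\<in>edges n. p e) / N"
  have sum_p: "(\<Sum>e\<in>edges n. p e) = N * u" using N by (simp add: u_def)
  have "0 \<le> (\<Sum>e\<in>edges n. p e)" using p by (intro sum_nonneg) auto
  moreover have "(\<Sum>e\<in>edges n. p e) \<le> N"
    using sum_mono[of "edges n" p "\<lambda>_. 1"] p by (simp add: N_def)
  ultimately have u: "0 \<le> u" "u \<le> 1" using N by (auto simp: u_def)
  consider "u = 0" | "u = 1" | "0 < u" "u < 1" using u by linarith
  then have "mean_field \<alpha> h n p \<le> mean_field \<alpha> h n (\<lambda>_. u)"
  proof cases
    case 1
    then have "\<forall>e\<in>edges n. p e = 0"
      using sum_p p by (subst sum_nonneg_eq_0_iff[symmetric]) (auto simp: finite_edges)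
    then show ?thesis using 1 by (intro eq_refl mean_field_cong) auto
  next
    case 2
    then have "(\<Sum>e\<in>edges n. 1 - p e) = 0" using sum_p by (simp add: sum_subtractf N_def)
    then have "\<forall>e\<in>edges n. 1 - p e = 0"
      using p by (subst sum_nonneg_eq_0_iff[symmetric]) (auto simp: finite_edges)
    then show ?thesis using 2 by (intro eq_refl mean_field_cong) auto
  next
    case 3
    define Q where "Q = (\<Sum>e\<in>edges n. (p e - u)\<^sup>2)"
    have Q: "Q \<ge> 0" by (auto simp: Q_def intro: sum_nonneg)
    have dev: "(\<Sum>e\<in>edges n. p e - u) = 0" using sum_p by (simp add: sum_subtractf N_def)
    define f where "f e = u ^ 3 / 3 + u\<^sup>2 * (p e - u) - (p e - u)\<^sup>2" for e
    have "(\<Sum>e\<in>edges n. f e) = (\<Sum>e\<in>edges n. u ^ 3 / 3) +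
        (\<Sum>e\<in>edges n. u\<^sup>2 * (p e - u)) - (\<Sum>e\<in>edges n. (p e - u)\<^sup>2)"
      by (simp only: f_def sum.distrib sum_subtractf)
    also have "\<dots> = N * (u ^ 3 / 3) + u\<^sup>2 * (\<Sum>e\<in>edges n. p e - u) - Q"
      by (simp only: Q_def N_def sum_distrib_left sum_constant)
    finally have "(real n - 2) * (N * (u ^ 3 / 3) - Q) = (real n - 2) * (\<Sum>e\<in>edges n. f e)"
      by (simp add: dev)
    also have "\<dots> = (\<Sum>c<n. \<Sum>b<c. \<Sum>a<b. f {a, b} + f {b, c} + f {a, c})"
      by (rule sum_triples_pairs[symmetric])
    also have "\<dots> \<le> (\<Sum>t\<in>triangles n. \<Prod>e\<in>t. p e)"
      unfolding sum_triangles
    proof (intro sum_mono)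
      fix a b c assume "c \<in> {..<n}" "b \<in> {..<c}" "a \<in> {..<b}"
      then have "{a, c} \<in> edges n" by (intro edge_memI) auto
      then show "f {a, b} + f {b, c} + f {a, c} \<le> p {a, b} * p {b, c} * p {a, c}"
        using prod3_ge_tangent[OF u, of "p {a, c}" "p {a, b}" "p {b, c}"] p
        by (simp add: f_def algebra_simps)
    qed
    finally have T: "\<alpha> / real n * (\<Sum>t\<in>triangles n. \<Prod>e\<in>t. p e) \<le>
        \<alpha> / real n * ((real n - 2) * (N * (u ^ 3 / 3) - Q))"
      using \<alpha> by (intro mult_left_mono_neg) (auto simp: divide_nonpos_nonneg)
    have "(\<Sum>e\<in>edges n. entropy_fun u + (ln u - ln (1 - u)) * (p e - u) + 2 * (p e - u)\<^sup>2) \<le>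
        (\<Sum>e\<in>edges n. entropy_fun (p e))"
      using p by (intro sum_mono entropy_fun_ge_tangent[OF 3]) auto
    also have "(\<Sum>e\<in>edges n. entropy_fun u + (ln u - ln (1 - u)) * (p e - u) + 2 * (p e - u)\<^sup>2) =
        N * entropy_fun u + (ln u - ln (1 - u)) * (\<Sum>e\<in>edges n. p e - u) + 2 * Q"
      by (simp add: sum.distrib sum_distrib_left Q_def N_def)
    finally have I: "N * entropy_fun u + 2 * Q \<le> (\<Sum>e\<in>edges n. entropy_fun (p e))"
      by (simp add: dev)
    have c: "mean_field \<alpha> h n (\<lambda>_. u) =
        \<alpha> / real n * ((real n - 2) * (N * (u ^ 3 / 3))) + h * (N * u) - N * entropy_fun u"
      using n by (subst mean_field_const) (auto simp: N_def real_card_edges scalar_fun_def field_simps)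
    have "- \<alpha> * (real n - 2) \<le> 2 * (real n - 2)" using \<alpha> n by (intro mult_right_mono) auto
    also have "\<dots> \<le> 2 * real n" by simp
    finally have "- \<alpha> / real n * (real n - 2) \<le> 2" using n by (simp add: field_simps)
    then have "- \<alpha> / real n * (real n - 2) * Q \<le> 2 * Q" using Q by (rule mult_right_mono)
    moreover have "\<alpha> / real n * ((real n - 2) * (N * (u ^ 3 / 3) - Q)) =
        \<alpha> / real n * ((real n - 2) * (N * (u ^ 3 / 3))) + - \<alpha> / real n * (real n - 2) * Q"
      by (simp add: algebra_simps)
    ultimately show ?thesis
      using T I c sum_p by (simp add: mean_field_def[of _ _ _ p] hamiltonian_def)
  qed
  then show ?thesis using u by blast
qed

text \<open>For negative \<open>\<alpha>\<close> the cubic correction at a constant is positive; the term \<open>\<bar>\<alpha>\<bar> n\<close> absorbs it.\<close>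

lemma mean_field_le:
  assumes \<alpha>: "- 2 \<le> \<alpha>" and p: "\<And>e. e \<in> edges n \<Longrightarrow> 0 \<le> p e \<and> p e \<le> 1"
    and m: "\<And>v. 0 \<le> v \<Longrightarrow> v \<le> 1 \<Longrightarrow> scalar_fun \<alpha> h v \<le> m"
  shows "mean_field \<alpha> h n p \<le> (real n)\<^sup>2 * m + \<bar>\<alpha>\<bar> * real n"
proof -
  have m0: "m \<ge> 0" using m[of 0] by (simp add: scalar_fun_def entropy_fun_def)
  then have nm: "real n * (real n - 1) * m \<le> (real n)\<^sup>2 * m"
    by (intro mult_right_mono) (auto simp: power2_eq_square algebra_simps)
  consider "\<alpha> \<ge> 0" | "\<alpha> < 0" "n \<ge> 2" | "n < 2" by linarith
  then show ?thesis
  proof cases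
    case 1
    have "mean_field \<alpha> h n p \<le> real n * (real n - 1) * m"
      using 1 p m by (rule mean_field_le_attractive)
    then show ?thesis using nm by (smt (verit) mult_nonneg_nonneg of_nat_0_le_iff)
  next
    case 2
    obtain u where u: "0 \<le> u" "u \<le> 1" "mean_field \<alpha> h n p \<le> mean_field \<alpha> h n (\<lambda>_. u)"
      using mean_field_le_repulsive[OF \<alpha> _ 2(2), of p h] p 2 by auto
    note u(3)
    also have "mean_field \<alpha> h n (\<lambda>_. u) =
        real n * (real n - 1) * scalar_fun \<alpha> h u + \<bar>\<alpha>\<bar> * ((real n - 1) * (u ^ 3 / 3))"
      using 2 by (subst mean_field_const) (auto simp: field_simps)
    also have "\<dots> \<le> real n * (real n - 1) * m + \<bar>\<alpha>\<bar> * (real n * 1)"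
      using u 2 m[OF u(1,2)] power_le_one[OF u(1,2), of 3]
      by (intro add_mono mult_left_mono mult_mono) auto
    finally show ?thesis using nm by simp
  next
    case 3
    then have "edges n = {}"
      using real_card_edges[of n] finite_edges[of n] by (cases "n = 0") (auto simp: less_2_cases_iff)
    moreover have "(\<Sum>t\<in>triangles n. \<Prod>e\<in>t. p e) = 0"
      using 3 by (auto simp: sum_triangles less_2_cases_iff)
    ultimately show ?thesis using m0 by (simp add: mean_field_def hamiltonian_def)
  qed
qed

section \<open>Conditional expectation on a finite probability space\<close>

locale finite_prob =
  fixes A :: "'a set" and w :: "'a \<Rightarrow> real"
  assumes finite_A: "finite A" and w_pos: "x \<in> A \<Longrightarrow> w x > 0" and w_total: "sum w A = 1"
begin

definition avg :: "('a \<Rightarrow> real) \<Rightarrow> real" where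
  "avg g = (\<Sum>x\<in>A. w x * g x)"

text \<open>Conditional expectation of \<open>g\<close> given the value of \<open>f\<close>. The class of a point of \<open>A\<close> is
never null, as all weights are positive.\<close>

definition cond :: "('a \<Rightarrow> 'b) \<Rightarrow> ('a \<Rightarrow> real) \<Rightarrow> 'a \<Rightarrow> real" where
  "cond f g x = (\<Sum>y | y \<in> A \<and> f y = f x. w y * g y) / (\<Sum>y | y \<in> A \<and> f y = f x. w y)"

lemma avg_mono: "(\<And>x. x \<in> A \<Longrightarrow> g x \<le> k x) \<Longrightarrow> avg g \<le> avg k"
  unfolding avg_def by (intro sum_mono mult_left_mono) (auto intro: less_imp_le w_pos)

lemma avg_cong: "(\<And>x. x \<in> A \<Longrightarrow> g x = k x) \<Longrightarrow> avg g = avg k"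
  unfolding avg_def by (intro sum.cong) auto

lemma avg_add: "avg (\<lambda>x. g x + k x) = avg g + avg k"
  by (simp add: avg_def algebra_simps sum.distrib)

lemma avg_diff: "avg (\<lambda>x. g x - k x) = avg g - avg k"
  by (simp add: avg_def algebra_simps sum_subtractf)

lemma avg_scale: "avg (\<lambda>x. c * g x) = c * avg g"
  by (simp add: avg_def algebra_simps sum_distrib_left)

lemma avg_sum: "avg (\<lambda>x. \<Sum>i\<in>I. g i x) = (\<Sum>i\<in>I. avg (g i))"
  unfolding avg_def sum_distrib_left by (rule sum.swap)

lemma avg_const: "avg (\<lambda>x. c) = c"
  using w_total by (simp add: avg_def flip: sum_distrib_right)

lemma class_weight_pos: "x \<in> A \<Longrightarrow> (\<Sum>y | y \<in> A \<and> f y = f x. w y) > 0"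
  by (rule sum_pos2[of _ x]) (auto simp: finite_A w_pos intro: less_imp_le)

lemma cond_cong: "f x = f y \<Longrightarrow> cond f g x = cond f g y"
  by (simp add: cond_def)

lemma cond_bounds:
  assumes "x \<in> A" "\<And>y. y \<in> A \<Longrightarrow> 0 \<le> g y \<and> g y \<le> 1"
  shows "0 \<le> cond f g x" "cond f g x \<le> 1"
proof -
  have "(\<Sum>y | y \<in> A \<and> f y = f x. w y * g y) \<le> (\<Sum>y | y \<in> A \<and> f y = f x. w y)"
    using assms(2) w_pos by (intro sum_mono) (simp add: mult_left_le less_imp_le)
  then show "cond f g x \<le> 1"
    unfolding cond_def by (subst divide_le_eq_1_pos[OF class_weight_pos[OF assms(1)]])
  show "0 \<le> cond f g x"
    unfolding cond_def using assms(2) w_pos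
    by (intro divide_nonneg_nonneg sum_nonneg mult_nonneg_nonneg) (auto intro: less_imp_le)
qed

lemma cond_pos:
  assumes "x \<in> A" "g x > 0" "\<And>y. y \<in> A \<Longrightarrow> 0 \<le> g y"
  shows "cond f g x > 0"
proof -
  have "(\<Sum>y | y \<in> A \<and> f y = f x. w y * g y) > 0"
    by (rule sum_pos2[of _ x]) (use assms w_pos finite_A in \<open>auto intro!: mult_nonneg_nonneg intro: less_imp_le\<close>)
  then show ?thesis
    unfolding cond_def by (intro divide_pos_pos class_weight_pos assms(1))
qed

text \<open>The defining property of conditional expectation, tested on functions \<open>k\<close> of \<open>f\<close>.\<close>

lemma avg_cond_mult:
  assumes "\<And>x y. x \<in> A \<Longrightarrow> y \<in> A \<Longrightarrow> f x = f y \<Longrightarrow> k x = k y"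
  shows "avg (\<lambda>x. cond f g x * k x) = avg (\<lambda>x. g x * k x)"
proof -
  have "(\<Sum>x | x \<in> A \<and> f x = r. w x * (cond f g x * k x)) =
      (\<Sum>x | x \<in> A \<and> f x = r. w x * (g x * k x))" if "r \<in> f ` A" for r
  proof -
    from that obtain z where z: "z \<in> A" "r = f z" by blast
    have "(\<Sum>x | x \<in> A \<and> f x = r. w x * (cond f g x * k x)) =
        (\<Sum>x | x \<in> A \<and> f x = f z. w x) * (cond f g z * k z)"
      unfolding sum_distrib_right
    proof (rule sum.cong)
      fix x assume "x \<in> {x \<in> A. f x = f z}"
      then have "x \<in> A" "f x = f z" by auto
      have "k x = k z" by (rule assms) fact+
      moreover have "cond f g x = cond f g z" by (rule cond_cong) fact
      ultimately show "w x * (cond f g x * k x) = w x * (cond f g z * k z)"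
        by (simp only:)
    qed (simp only: z)
    also have "\<dots> = (\<Sum>x | x \<in> A \<and> f x = f z. w x * g x) * k z"
    proof -
      have "W * (N / W * c) = N * c" if "W > 0" for W N c :: real
        using that by simp
      from this[OF class_weight_pos[OF z(1)]] show ?thesis unfolding cond_def .
    qed
    also have "\<dots> = (\<Sum>x | x \<in> A \<and> f x = r. w x * (g x * k x))"
      unfolding sum_distrib_right
    proof (rule sum.cong)
      fix x assume "x \<in> {x \<in> A. f x = r}"
      then have "x \<in> A" "f x = f z" using z by auto
      then show "w x * g x * k z = w x * (g x * k x)"
        using assms[of x z] z(1) by (metis mult.assoc)
    qed (simp only: z)
    finally show ?thesis .
  qed
  moreover have "avg k' = (\<Sum>r\<in>f ` A. \<Sum>x | x \<in> A \<and> f x = r. w x * k' x)" for k'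
    unfolding avg_def by (rule sum.image_gen[OF finite_A])
  ultimately show ?thesis by (simp only:) (rule sum.cong[OF refl])
qed

lemma avg_cond: "avg (cond f g) = avg g"
  using avg_cond_mult[of f "\<lambda>_. 1" g] by simp

text \<open>Conditional expectations along refining information form a martingale, so their increments are
orthogonal.\<close>

lemma cond_pythagoras:
  assumes "\<And>x y. x \<in> A \<Longrightarrow> y \<in> A \<Longrightarrow> f' x = f' y \<Longrightarrow> f x = f y"
  shows "avg (\<lambda>x. (cond f' g x - cond f g x)\<^sup>2) = avg (\<lambda>x. (cond f' g x)\<^sup>2) - avg (\<lambda>x. (cond f g x)\<^sup>2)"
proof -
  have "avg (\<lambda>x. cond f' g x * cond f g x) = avg (\<lambda>x. g x * cond f g x)"
    by (rule avg_cond_mult, rule cond_cong, rule assms)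
  also have "\<dots> = avg (\<lambda>x. cond f g x * cond f g x)"
    by (rule avg_cond_mult[symmetric], rule cond_cong)
  finally have "avg (\<lambda>x. cond f' g x * cond f g x) = avg (\<lambda>x. (cond f g x)\<^sup>2)"
    by (simp add: power2_eq_square)
  moreover have "avg (\<lambda>x. (cond f' g x - cond f g x)\<^sup>2) =
      avg (\<lambda>x. (cond f' g x)\<^sup>2) - 2 * avg (\<lambda>x. cond f' g x * cond f g x) + avg (\<lambda>x. (cond f g x)\<^sup>2)"
    unfolding power2_diff by (simp add: avg_add avg_diff avg_scale mult.assoc)
  ultimately show ?thesis by simp
qed

text \<open>Nonnegativity of relative entropy, from \<open>ln y \<le> y - 1\<close>. The competitor \<open>\<nu>\<close> may be a subprobability,
which saves normalizing the measure used for the upper bound below.\<close>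

lemma gibbs_inequality:
  assumes "\<And>x. x \<in> A \<Longrightarrow> \<nu> x > 0" "sum \<nu> A \<le> 1"
  shows "avg (\<lambda>x. ln (\<nu> x)) \<le> avg (\<lambda>x. ln (w x))"
proof -
  have "avg (\<lambda>x. ln (\<nu> x) - ln (w x)) \<le> avg (\<lambda>x. \<nu> x / w x - 1)"
  proof (rule avg_mono)
    fix x assume x: "x \<in> A"
    then have "ln (\<nu> x / w x) \<le> \<nu> x / w x - 1"
      using assms(1) w_pos by (intro ln_le_minus_one) auto
    then show "ln (\<nu> x) - ln (w x) \<le> \<nu> x / w x - 1"
      using x assms(1)[OF x] w_pos[OF x] by (simp add: ln_div)
  qed
  also have "\<dots> = sum \<nu> A - 1"
  proof -
    have "w x * (\<nu> x / w x) = \<nu> x" if "x \<in> A" for x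
      using w_pos[OF that] by simp
    then show ?thesis unfolding avg_diff avg_const by (simp add: avg_def)
  qed
  finally show ?thesis using assms(2) by (simp add: avg_diff)
qed

end

lemma finite_gibbs_variational:
  fixes H \<nu> :: "'a \<Rightarrow> real"
  assumes "finite A" "A \<noteq> {}" "\<And>x. x \<in> A \<Longrightarrow> \<nu> x > 0" "sum \<nu> A = 1"
  shows "(\<Sum>x\<in>A. \<nu> x * (H x - ln (\<nu> x))) \<le> ln (\<Sum>x\<in>A. exp (H x))"
proof -
  interpret finite_prob A \<nu>
    using assms by unfold_locales
  define Z where "Z = (\<Sum>x\<in>A. exp (H x))"
  have Z: "Z > 0" unfolding Z_def using assms by (intro sum_pos) auto
  have "avg (\<lambda>x. ln (exp (H x) / Z)) \<le> avg (\<lambda>x. ln (\<nu> x))"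
    using Z by (intro gibbs_inequality) (auto simp: Z_def simp flip: sum_divide_distrib)
  then have "avg H - ln Z \<le> avg (\<lambda>x. ln (\<nu> x))"
    using Z by (simp add: ln_div avg_diff avg_const)
  then show ?thesis
    by (simp add: Z_def[symmetric] avg_def right_diff_distrib sum_subtractf)
qed

section \<open>Lower bound on the partition function\<close>

definition bern :: "real \<Rightarrow> real \<Rightarrow> real" where
  "bern p v = (if v = 1 then p else 1 - p)"

lemma sum_configs_prod:
  "(\<Sum>x\<in>configs n. \<Prod>e\<in>edges n. \<phi> e (x e)) = (\<Prod>e\<in>edges n. \<phi> e 0 + \<phi> e 1 :: real)"
  unfolding configs_def by (subst prod_sum_PiE[symmetric]) (auto simp: finite_edges)

lemma configs_edge: "x \<in> configs n \<Longrightarrow> e \<in> edges n \<Longrightarrow> x e = 0 \<or> x e = 1"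
  by (auto simp: configs_def)

lemma configs_nonempty: "configs n \<noteq> {}"
  by (simp add: configs_def PiE_eq_empty_iff)

lemma ln_bern: "v = 0 \<or> v = 1 \<Longrightarrow> ln (bern p v) = v * ln p + (1 - v) * ln (1 - p)"
  by (auto simp: bern_def)

lemma bernoulli_moment:
  assumes "T \<subseteq> edges n"
  shows "(\<Sum>x\<in>configs n. (\<Prod>e\<in>edges n. bern u (x e)) * (\<Prod>e\<in>T. x e)) = u ^ card T"
proof -
  have "(\<Sum>x\<in>configs n. (\<Prod>e\<in>edges n. bern u (x e)) * (\<Prod>e\<in>T. x e)) =
      (\<Sum>x\<in>configs n. \<Prod>e\<in>edges n. bern u (x e) * (if e \<in> T then x e else 1))"
    using assms finite_edges[of n]
    by (simp add: prod.distrib prod.If_cases Int_absorb1)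
  also have "\<dots> = (\<Prod>e\<in>edges n. if e \<in> T then u else 1)"
    unfolding sum_configs_prod[of "\<lambda>e v. bern u v * (if e \<in> T then v else 1)" n]
    by (intro prod.cong) (auto simp: bern_def)
  also have "\<dots> = u ^ card T"
    using assms finite_edges[of n] by (simp add: prod.If_cases Int_absorb1)
  finally show ?thesis .
qed

text \<open>Test the Gibbs variational principle on independent edges of density \<open>u\<close>: the Hamiltonian is
multilinear in the edges, so its expectation is its value at the constant \<open>u\<close>.\<close>

lemma partition_function_ge:
  assumes u: "0 < u" "u < 1"
  shows "mean_field \<alpha> h n (\<lambda>_. u) \<le> ln (partition_function \<alpha> h n)"
proof -
  define \<nu> where "\<nu> x = (\<Prod>e\<in>edges n. bern u (x e))" for x
  have E: "(\<Sum>x\<in>configs n. \<nu> x * x e) = u" if "e \<in> edges n" for e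
    using bernoulli_moment[of "{e}" n u] that by (simp add: \<nu>_def)
  have T: "(\<Sum>x\<in>configs n. \<nu> x * (\<Prod>e\<in>t. x e)) = (\<Prod>e\<in>t. u)" if "t \<in> triangles n" for t
    using bernoulli_moment[of t n u] that by (auto simp: \<nu>_def triangles_def edge_memI)
  have 1: "sum \<nu> (configs n) = 1"
    using bernoulli_moment[of "{}" n u] by (simp add: \<nu>_def)
  have pos: "\<nu> x > 0" for x
    unfolding \<nu>_def using u by (intro prod_pos) (simp add: bern_def)
  have ln: "ln (\<nu> x) = (\<Sum>e\<in>edges n. x e * ln u + (1 - x e) * ln (1 - u))" if "x \<in> configs n" for x
  proof -
    have "ln (\<nu> x) = (\<Sum>e\<in>edges n. ln (bern u (x e)))"
      unfolding \<nu>_def using u by (intro ln_prod) (auto simp: bern_def finite_edges)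
    also have "\<dots> = (\<Sum>e\<in>edges n. x e * ln u + (1 - x e) * ln (1 - u))"
      by (intro sum.cong refl ln_bern configs_edge[OF that])
    finally show ?thesis .
  qed
  have E': "(\<Sum>x\<in>configs n. \<Sum>e\<in>edges n. \<nu> x * x e) = (\<Sum>e\<in>edges n. u)"
    by (subst sum.swap) (simp add: E)
  have T': "(\<Sum>x\<in>configs n. \<Sum>t\<in>triangles n. \<nu> x * (\<Prod>e\<in>t. x e)) = (\<Sum>t\<in>triangles n. \<Prod>e\<in>t. u)"
    by (subst sum.swap) (rule sum.cong[OF refl T])
  have H: "(\<Sum>x\<in>configs n. \<nu> x * hamiltonian \<alpha> h n x) = hamiltonian \<alpha> h n (\<lambda>_. u)"
    unfolding hamiltonian_def T'[symmetric] E'[symmetric]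
    by (simp add: distrib_left sum.distrib sum_distrib_left mult.left_commute)
  have "(\<Sum>x\<in>configs n. \<nu> x * ln (\<nu> x)) =
      (\<Sum>x\<in>configs n. \<Sum>e\<in>edges n. ln u * (\<nu> x * x e) + ln (1 - u) * (\<nu> x - \<nu> x * x e))"
    by (intro sum.cong refl) (simp add: ln sum_distrib_left algebra_simps)
  also have "\<dots> = (\<Sum>e\<in>edges n. \<Sum>x\<in>configs n. ln u * (\<nu> x * x e) + ln (1 - u) * (\<nu> x - \<nu> x * x e))"
    by (rule sum.swap)
  also have "\<dots> = (\<Sum>e\<in>edges n. entropy_fun u)"
  proof (rule sum.cong[OF refl])
    fix e assume "e \<in> edges n"
    then have "(\<Sum>x\<in>configs n. ln u * (\<nu> x * x e) + ln (1 - u) * (\<nu> x - \<nu> x * x e)) =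
        ln u * u + ln (1 - u) * (1 - u)"
      by (simp only: sum.distrib sum_subtractf sum_distrib_left[symmetric] E 1)
    then show "(\<Sum>x\<in>configs n. ln u * (\<nu> x * x e) + ln (1 - u) * (\<nu> x - \<nu> x * x e)) = entropy_fun u"
      by (simp add: entropy_fun_def)
  qed
  finally have "(\<Sum>x\<in>configs n. \<nu> x * (hamiltonian \<alpha> h n x - ln (\<nu> x))) = mean_field \<alpha> h n (\<lambda>_. u)"
    using H by (simp only: right_diff_distrib sum_subtractf mean_field_def)
  then show ?thesis
    using finite_gibbs_variational[OF finite_configs configs_nonempty pos 1, of "hamiltonian \<alpha> h n"]
    by (simp add: partition_function_def)
qed

section \<open>Upper bound on the partition function\<close>

context finite_prob
begin

lemma abs_avg_le: "\<bar>avg g\<bar> \<le> avg (\<lambda>x. \<bar>g x\<bar>)"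
  unfolding avg_def using w_pos
  by (intro order_trans[OF sum_abs] sum_mono) (simp add: abs_mult less_imp_le)

lemma cond_compl: "x \<in> A \<Longrightarrow> cond f (\<lambda>y. 1 - g y) x = 1 - cond f g x"
  using class_weight_pos[of x f]
  by (simp add: cond_def right_diff_distrib sum_subtractf diff_divide_distrib)

text \<open>If \<open>k\<close> is a function of the finer information \<open>f'\<close>, then \<open>g\<close> may be replaced in \<open>avg (g k)\<close> by its
conditional expectation given \<open>f'\<close>. Passing further to the coarser \<open>f\<close> costs only as much as the two
conditional expectations differ.\<close>

lemma avg_cond_replace:
  assumes refine: "\<And>x y. x \<in> A \<Longrightarrow> y \<in> A \<Longrightarrow> f' x = f' y \<Longrightarrow> f x = f y"
    and meas: "\<And>x y. x \<in> A \<Longrightarrow> y \<in> A \<Longrightarrow> f' x = f' y \<Longrightarrow> k x = k y"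
    and bound: "\<And>x. x \<in> A \<Longrightarrow> \<bar>k x\<bar> \<le> 1"
  shows "\<bar>avg (\<lambda>x. g x * k x) - avg (\<lambda>x. cond f g x * k x)\<bar> \<le> avg (\<lambda>x. \<bar>cond f' g x - cond f g x\<bar>)"
proof -
  have "avg (\<lambda>x. g x * k x) = avg (\<lambda>x. cond f' g x * k x)"
    by (rule avg_cond_mult[symmetric], rule meas)
  then have "avg (\<lambda>x. g x * k x) - avg (\<lambda>x. cond f g x * k x) = avg (\<lambda>x. (cond f' g x - cond f g x) * k x)"
    by (simp add: left_diff_distrib avg_diff)
  also have "\<bar>\<dots>\<bar> \<le> avg (\<lambda>x. \<bar>(cond f' g x - cond f g x) * k x\<bar>)"
    by (rule abs_avg_le)
  also have "\<dots> \<le> avg (\<lambda>x. \<bar>cond f' g x - cond f g x\<bar>)"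
    using bound by (intro avg_mono) (simp add: abs_mult mult_left_le)
  finally show ?thesis .
qed

end

text \<open>Add vertices one at a time as long as this raises \<open>Q\<close> by more than \<open>\<delta>\<close>; the bound on \<open>Q\<close> stops this within
\<open>K\<close> steps.\<close>

lemma energy_increment:
  fixes Q :: "'v set \<Rightarrow> real"
  assumes bound: "\<And>V. V \<subseteq> U \<Longrightarrow> Q V \<le> B" and "0 \<le> Q {}" "B < \<delta> * (real K + 1)"
  shows "\<exists>V\<subseteq>U. finite V \<and> card V \<le> K \<and> (\<forall>v\<in>U. Q (insert v V) \<le> Q V + \<delta>)"
proof (rule ccontr)
  assume none: "\<not> ?thesis"
  have "\<exists>V\<subseteq>U. finite V \<and> card V \<le> k \<and> \<delta> * real k \<le> Q V" if "k \<le> K + 1" for k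
    using that
  proof (induction k)
    case 0
    then show ?case using assms(2) by auto
  next
    case (Suc k)
    then obtain V where V: "V \<subseteq> U" "finite V" "card V \<le> k" "\<delta> * real k \<le> Q V" by auto
    then obtain v where v: "v \<in> U" "Q V + \<delta> < Q (insert v V)"
      using none Suc.prems by (metis Suc_eq_plus1 Suc_le_mono le_trans not_le)
    then have "insert v V \<subseteq> U" "finite (insert v V)" "card (insert v V) \<le> Suc k"
      "\<delta> * real (Suc k) \<le> Q (insert v V)"
      using V card_insert_le_m1[of "Suc k" V v] by (auto simp: algebra_simps)
    then show ?case by blast
  qed
  from this[of "K + 1"] obtain V where "V \<subseteq> U" "\<delta> * (real K + 1) \<le> Q V" by (auto simp: add.commute)
  then show False using bound[of V] assms(3) by simp
qed

definition revealed :: "nat \<Rightarrow> nat set \<Rightarrow> nat set set" where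
  "revealed n V = {e \<in> edges n. e \<inter> V \<noteq> {}}"

lemma card_revealed_le:
  assumes "finite V"
  shows "card (revealed n V) \<le> n * card V"
proof -
  have "revealed n V \<subseteq> (\<lambda>(v, u). {v, u}) ` (V \<times> {..<n})"
  proof
    fix e assume "e \<in> revealed n V"
    then obtain a b where e: "e = {a, b}" "a < n" "b < n" "a \<in> V \<or> b \<in> V"
      by (auto simp: revealed_def edges_def card_2_iff)
    then show "e \<in> (\<lambda>(v, u). {v, u}) ` (V \<times> {..<n})"
      by (auto simp: image_iff insert_commute)
  qed
  then have "card (revealed n V) \<le> card ((\<lambda>(v, u). {v, u}) ` (V \<times> {..<n}))"
    using assms by (intro card_mono) auto
  also have "\<dots> \<le> card (V \<times> {..<n})" using assms by (intro card_image_le) auto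
  finally show ?thesis by (simp add: card_cartesian_product mult.commute)
qed

text \<open>On each of the at most \<open>2 ^ card R\<close> classes of configurations that agree on \<open>R\<close> the weight is that of a
fixed product measure, so it sums to at most 1.\<close>

lemma sum_prod_bern_le:
  assumes R: "R \<subseteq> edges n"
    and P: "\<And>e x y. x \<in> configs n \<Longrightarrow> y \<in> configs n \<Longrightarrow> restrict x R = restrict y R \<Longrightarrow> P e x = P e y"
    and P01: "\<And>e x. e \<in> edges n \<Longrightarrow> x \<in> configs n \<Longrightarrow> 0 \<le> P e x \<and> P e x \<le> 1"
  shows "(\<Sum>x\<in>configs n. \<Prod>e\<in>edges n. bern (P e x) (x e)) \<le> 2 ^ card R"
proof -
  let ?f = "\<lambda>x :: nat set \<Rightarrow> real. restrict x R"
  have finR: "finite R" using R finite_edges finite_subset by blast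
  have "(\<Sum>x | x \<in> configs n \<and> ?f x = r. \<Prod>e\<in>edges n. bern (P e x) (x e)) \<le> 1"
    if "r \<in> ?f ` configs n" for r
  proof -
    from that obtain z where z: "z \<in> configs n" "r = ?f z" by blast
    have "(\<Sum>x | x \<in> configs n \<and> ?f x = r. \<Prod>e\<in>edges n. bern (P e x) (x e)) =
        (\<Sum>x | x \<in> configs n \<and> ?f x = r. \<Prod>e\<in>edges n. bern (P e z) (x e))"
    proof (rule sum.cong[OF refl])
      fix x assume "x \<in> {x \<in> configs n. ?f x = r}"
      then have "x \<in> configs n" "?f x = ?f z" using z by auto
      then have "P e x = P e z" for e using P z(1) by metis
      then show "(\<Prod>e\<in>edges n. bern (P e x) (x e)) = (\<Prod>e\<in>edges n. bern (P e z) (x e))" by simp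
    qed
    also have "\<dots> \<le> (\<Sum>x\<in>configs n. \<Prod>e\<in>edges n. bern (P e z) (x e))"
      using P01[OF _ z(1)] by (intro sum_mono2 finite_configs prod_nonneg) (auto simp: bern_def)
    also have "\<dots> = 1"
      by (subst sum_configs_prod) (simp add: bern_def)
    finally show ?thesis .
  qed
  then have "(\<Sum>r\<in>?f ` configs n. \<Sum>x | x \<in> configs n \<and> ?f x = r. \<Prod>e\<in>edges n. bern (P e x) (x e))
      \<le> (\<Sum>r\<in>?f ` configs n. 1)"
    by (rule sum_mono)
  also have "\<dots> = real (card (?f ` configs n))" by simp
  finally have sum_le: "(\<Sum>r\<in>?f ` configs n. \<Sum>x | x \<in> configs n \<and> ?f x = r. \<Prod>e\<in>edges n. bern (P e x) (x e))
      \<le> real (card (?f ` configs n))" .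
  have "card (?f ` configs n) \<le> card (R \<rightarrow>\<^sub>E {0, 1 :: real})"
    using R finR by (intro card_mono finite_PiE) (auto simp: configs_def)
  also have "card (R \<rightarrow>\<^sub>E {0, 1 :: real}) = 2 ^ card R"
    using finR by (simp add: card_PiE numeral_2_eq_2)
  finally have "real (card (?f ` configs n)) \<le> 2 ^ card R"
    by (metis of_nat_le_iff of_nat_numeral of_nat_power)
  from order_trans[OF sum_le this] show ?thesis
    by (subst sum.image_gen[OF finite_configs, where g = ?f])
qed

text \<open>The parameter \<open>r\<close> trades the correlation error \<open>2\<bar>\<alpha>\<bar> n\<^sup>2/r\<close> against the entropy \<open>n r\<^sup>2 ln 2\<close> of the revealed
edges: the set \<open>V\<close> has at most \<open>r\<^sup>2\<close> vertices.\<close>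

lemma partition_function_le:
  assumes \<alpha>: "- 2 \<le> \<alpha>" and m: "\<And>v. 0 \<le> v \<Longrightarrow> v \<le> 1 \<Longrightarrow> scalar_fun \<alpha> h v \<le> m"
    and n: "n > 0" and r: "r > 0"
  shows "ln (partition_function \<alpha> h n) \<le>
    (real n)\<^sup>2 * m + \<bar>\<alpha>\<bar> * real n + 2 * \<bar>\<alpha>\<bar> * (real n)\<^sup>2 / real r + real n * (real r)\<^sup>2 * ln 2"
proof -
  define Z where "Z = partition_function \<alpha> h n"
  have Z: "Z > 0" by (simp add: Z_def partition_function_pos)
  interpret G: finite_prob "configs n" "\<lambda>x. exp (hamiltonian \<alpha> h n x) / Z"
    using Z by unfold_locales (auto simp: finite_configs Z_def partition_function_def simp flip: sum_divide_distrib)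
  define F :: "nat set \<Rightarrow> (nat set \<Rightarrow> real) \<Rightarrow> nat set \<Rightarrow> real"
    where "F V x = restrict x (revealed n V)" for V x
  define P where "P V e = G.cond (F V) (\<lambda>x. x e)" for V e
  have F_refine: "F V x = F V y" if "V \<subseteq> W" "F W x = F W y" for V W x y
  proof -
    have "revealed n V \<subseteq> revealed n W" using that(1) by (auto simp: revealed_def)
    then have "F V x = restrict (F W x) (revealed n V)" for x
      by (auto simp: F_def Int_absorb1)
    then show ?thesis using that(2) by simp
  qed
  have F_edge: "x e = y e" if "F V x = F V y" "e \<in> edges n" "v \<in> e" "v \<in> V" for V x y e v
  proof -
    have "e \<in> revealed n V" using that(2-4) by (auto simp: revealed_def)
    moreover have "F V x e = F V y e" using that(1) by (rule fun_cong)
    ultimately show ?thesis by (simp add: F_def)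
  qed
  have P_meas: "P V e x = P V e y" if "F V x = F V y" for V e x y
    unfolding P_def by (rule G.cond_cong) fact
  have P01: "0 \<le> P V e x" "P V e x \<le> 1" if "e \<in> edges n" "x \<in> configs n" for V e x
    unfolding P_def using that configs_edge[OF _ that(1)] by (intro G.cond_bounds; force)+
  (* The energy whose increments measure how much one more vertex tells about the other edges. *)
  define Q where "Q V = (\<Sum>e\<in>edges n. G.avg (\<lambda>x. (P V e x)\<^sup>2))" for V
  have card_E: "real (card (edges n)) \<le> (real n)\<^sup>2 / 2"
    by (simp add: real_card_edges power2_eq_square algebra_simps)
  have "Q V \<le> (real n)\<^sup>2 / 2" for V
  proof -
    have "Q V \<le> (\<Sum>e\<in>edges n. G.avg (\<lambda>x. 1))"
      unfolding Q_def by (intro sum_mono G.avg_mono power_le_one P01)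
    then show ?thesis using card_E by (simp add: G.avg_const)
  qed
  moreover have "0 \<le> Q {}"
    unfolding Q_def G.avg_def using Z by (intro sum_nonneg mult_nonneg_nonneg) auto
  moreover have "(real n)\<^sup>2 / 2 < (real n)\<^sup>2 / (real r)\<^sup>2 * (real (r\<^sup>2) + 1)"
    using n r by (simp add: field_simps add_pos_pos)
  ultimately obtain V where V: "V \<subseteq> {..<n}" "finite V" "card V \<le> r\<^sup>2"
    "\<And>v. v < n \<Longrightarrow> Q (insert v V) \<le> Q V + (real n)\<^sup>2 / (real r)\<^sup>2"
    using energy_increment[of "{..<n}" Q "(real n)\<^sup>2 / 2" "(real n)\<^sup>2 / (real r)\<^sup>2" "r\<^sup>2"] by auto
  define p where "p = P V"
  note p01 = P01[of _ _ V, folded p_def]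
  define D where "D v e = G.avg (\<lambda>x. \<bar>P (insert v V) e x - p e x\<bar>)" for v e
  have D_nonneg: "0 \<le> D v e" for v e
    unfolding D_def G.avg_def using Z by (intro sum_nonneg) auto
  have D_sum: "(\<Sum>e\<in>edges n. D v e) \<le> (real n)\<^sup>2 / real r" if v: "v < n" for v
  proof -
    have "D v e \<le> 1 / (2 * real r) + real r / 2 *
        (G.avg (\<lambda>x. (P (insert v V) e x)\<^sup>2) - G.avg (\<lambda>x. (p e x)\<^sup>2))" for e
    proof -
      (* Young's inequality with weight r balances the two terms below, as
         the mean square increments sum to at most n^2 / r^2. *)
      have amgm: "\<bar>d\<bar> \<le> 1 / (2 * real r) + real r / 2 * d\<^sup>2" for d
      proof -
        have "0 \<le> (real r * \<bar>d\<bar> - 1)\<^sup>2 / (2 * real r)" by simp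
        also have "\<dots> = 1 / (2 * real r) + real r / 2 * d\<^sup>2 - \<bar>d\<bar>"
          using r by (simp add: power2_eq_square field_simps)
        finally show ?thesis by simp
      qed
      have "D v e \<le> G.avg (\<lambda>x. 1 / (2 * real r) + real r / 2 * (P (insert v V) e x - p e x)\<^sup>2)"
        unfolding D_def by (intro G.avg_mono amgm)
      also have "\<dots> = 1 / (2 * real r) + real r / 2 * G.avg (\<lambda>x. (P (insert v V) e x - p e x)\<^sup>2)"
        by (simp only: G.avg_add G.avg_const G.avg_scale)
      also have "G.avg (\<lambda>x. (P (insert v V) e x - p e x)\<^sup>2) =
          G.avg (\<lambda>x. (P (insert v V) e x)\<^sup>2) - G.avg (\<lambda>x. (p e x)\<^sup>2)"
        unfolding P_def p_def by (rule G.cond_pythagoras, rule F_refine[of V]) auto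
      finally show ?thesis .
    qed
    then have "(\<Sum>e\<in>edges n. D v e) \<le> (\<Sum>e\<in>edges n. 1 / (2 * real r) + real r / 2 *
        (G.avg (\<lambda>x. (P (insert v V) e x)\<^sup>2) - G.avg (\<lambda>x. (p e x)\<^sup>2)))"
      by (rule sum_mono)
    also have "\<dots> = real (card (edges n)) * (1 / (2 * real r)) + real r / 2 * (Q (insert v V) - Q V)"
      by (simp only: sum.distrib sum_constant sum_distrib_left[symmetric] sum_subtractf Q_def p_def)
    also have "\<dots> \<le> (real n)\<^sup>2 / 2 * (1 / (2 * real r)) + real r / 2 * ((real n)\<^sup>2 / (real r)\<^sup>2)"
      using card_E V(4)[OF v] by (intro add_mono mult_left_mono mult_right_mono) auto
    also have "\<dots> \<le> (real n)\<^sup>2 / real r"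
      using r by (simp add: field_simps power2_eq_square)
    finally show ?thesis .
  qed
  (* Replace the three edges by their conditional probabilities one after the other. The error of the
     first two replacements comes from revealing c and b; the third one is exact, as the other
     two factors are by then functions of the revealed edges. *)
  have triple: "G.avg (\<lambda>x. x {a, b} * x {b, c} * x {a, c}) \<le>
        G.avg (\<lambda>x. p {a, b} x * p {b, c} x * p {a, c} x) + (D c {a, b} + D b {a, c}) \<and>
      G.avg (\<lambda>x. p {a, b} x * p {b, c} x * p {a, c} x) \<le>
        G.avg (\<lambda>x. x {a, b} * x {b, c} * x {a, c}) + (D c {a, b} + D b {a, c})"
    if abc: "a < b" "b < c" "c < n" for a b c
  proof -
    have E: "{a, b} \<in> edges n" "{b, c} \<in> edges n" "{a, c} \<in> edges n"
      using abc by (auto intro!: edge_memI)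
    have x1: "\<bar>x e\<bar> \<le> 1" if "x \<in> configs n" "e \<in> edges n" for x e
      using configs_edge[OF that] by auto
    have p1: "\<bar>p e x\<bar> \<le> 1" if "x \<in> configs n" "e \<in> edges n" for x e
      using p01[OF that(2,1)] by simp
    have prod1: "\<bar>s * t\<bar> \<le> 1" if "\<bar>s\<bar> \<le> 1" "\<bar>t\<bar> \<le> 1" for s t :: real
      using mult_mono[OF that] by (simp add: abs_mult)
    have "\<bar>G.avg (\<lambda>x. x {a, b} * (x {b, c} * x {a, c})) - G.avg (\<lambda>x. p {a, b} x * (x {b, c} * x {a, c}))\<bar>
        \<le> D c {a, b}"
      unfolding D_def P_def p_def
    proof (rule G.avg_cond_replace)
      fix x y assume xy: "F (insert c V) x = F (insert c V) y"
      show "F V x = F V y" by (rule F_refine[OF _ xy]) auto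
      show "x {b, c} * x {a, c} = y {b, c} * y {a, c}"
        using F_edge[OF xy E(2), of c] F_edge[OF xy E(3), of c] by simp
    qed (intro prod1 x1 E)
    moreover have "\<bar>G.avg (\<lambda>x. x {a, c} * (p {a, b} x * x {b, c})) -
        G.avg (\<lambda>x. p {a, c} x * (p {a, b} x * x {b, c}))\<bar> \<le> D b {a, c}"
      unfolding D_def P_def p_def
    proof (rule G.avg_cond_replace)
      fix x y assume xy: "F (insert b V) x = F (insert b V) y"
      show V: "F V x = F V y" by (rule F_refine[OF _ xy]) auto
      show "G.cond (F V) (\<lambda>x. x {a, b}) x * x {b, c} = G.cond (F V) (\<lambda>x. x {a, b}) y * y {b, c}"
        using F_edge[OF xy E(2), of b] G.cond_cong[of "F V" x y, OF V] by simp
    next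
      fix x assume x: "x \<in> configs n"
      show "\<bar>G.cond (F V) (\<lambda>x. x {a, b}) x * x {b, c}\<bar> \<le> 1"
        by (rule prod1[OF p1[OF x E(1), unfolded p_def P_def] x1[OF x E(2)]])
    qed
    moreover have "G.avg (\<lambda>x. p {b, c} x * (p {a, b} x * p {a, c} x)) =
        G.avg (\<lambda>x. x {b, c} * (p {a, b} x * p {a, c} x))"
      unfolding p_def P_def[of V "{b, c}"]
      by (rule G.avg_cond_mult) (metis P_meas)
    ultimately show ?thesis by (simp add: mult_ac abs_le_iff)
  qed
  define err where "err = (\<Sum>c<n. \<Sum>b<c. \<Sum>a<b. D c {a, b} + D b {a, c})"
  have err: "err \<le> 2 * (real n * ((real n)\<^sup>2 / real r))"
  proof -
    have "(\<Sum>c<n. \<Sum>b<c. \<Sum>a<b. D c {a, b}) \<le> (\<Sum>c<n. \<Sum>b<n. \<Sum>a<b. D c {a, b})"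
      by (intro sum_mono sum_mono2 sum_nonneg D_nonneg) auto
    also have "\<dots> = (\<Sum>c<n. \<Sum>e\<in>edges n. D c e)" by (simp only: sum_edges)
    finally have 1: "(\<Sum>c<n. \<Sum>b<c. \<Sum>a<b. D c {a, b}) \<le> (\<Sum>c<n. \<Sum>e\<in>edges n. D c e)" .
    have "(\<Sum>c<n. \<Sum>b<c. \<Sum>a<b. D b {a, c}) \<le> (\<Sum>c<n. \<Sum>b<c. \<Sum>a<c. D b {a, c})"
      by (intro sum_mono sum_mono2 D_nonneg) auto
    also have "\<dots> \<le> (\<Sum>c<n. \<Sum>b<n. \<Sum>a<c. D b {a, c})"
      by (intro sum_mono sum_mono2 sum_nonneg D_nonneg) auto
    also have "\<dots> = (\<Sum>b<n. \<Sum>c<n. \<Sum>a<c. D b {a, c})" by (rule sum.swap)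
    also have "\<dots> = (\<Sum>b<n. \<Sum>e\<in>edges n. D b e)" by (simp only: sum_edges)
    finally have 2: "(\<Sum>c<n. \<Sum>b<c. \<Sum>a<b. D b {a, c}) \<le> (\<Sum>b<n. \<Sum>e\<in>edges n. D b e)" .
    have "(\<Sum>v<n. \<Sum>e\<in>edges n. D v e) \<le> (\<Sum>v<n. (real n)\<^sup>2 / real r)"
      using D_sum by (intro sum_mono) auto
    then show ?thesis using 1 2 by (simp add: err_def sum.distrib)
  qed
  define T where "T q = (\<Sum>t\<in>triangles n. \<Prod>e\<in>t. q e)" for q :: "nat set \<Rightarrow> real"
  have T: "\<bar>G.avg T - G.avg (\<lambda>x. T (\<lambda>e. p e x))\<bar> \<le> err"
  proof -
    have "G.avg T \<le> G.avg (\<lambda>x. T (\<lambda>e. p e x)) + err"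
      unfolding T_def sum_triangles G.avg_sum err_def sum.distrib[symmetric]
      using triple by (intro sum_mono) auto
    moreover have "G.avg (\<lambda>x. T (\<lambda>e. p e x)) \<le> G.avg T + err"
      unfolding T_def sum_triangles G.avg_sum err_def sum.distrib[symmetric]
      using triple by (intro sum_mono) auto
    ultimately show ?thesis by (simp add: abs_le_iff)
  qed
  have avg_T: "\<alpha> / real n * G.avg T \<le>
      \<alpha> / real n * G.avg (\<lambda>x. T (\<lambda>e. p e x)) + 2 * \<bar>\<alpha>\<bar> * (real n)\<^sup>2 / real r"
  proof -
    have "\<alpha> / real n * (G.avg T - G.avg (\<lambda>x. T (\<lambda>e. p e x))) \<le>
        \<bar>\<alpha>\<bar> / real n * \<bar>G.avg T - G.avg (\<lambda>x. T (\<lambda>e. p e x))\<bar>"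
      by (rule order_trans[OF abs_ge_self]) (simp add: abs_mult)
    also have "\<dots> \<le> \<bar>\<alpha>\<bar> / real n * (2 * (real n * ((real n)\<^sup>2 / real r)))"
      using T err by (intro mult_left_mono) auto
    also have "\<dots> = 2 * \<bar>\<alpha>\<bar> * (real n)\<^sup>2 / real r"
      using n by simp
    finally show ?thesis by (simp add: right_diff_distrib)
  qed
  have avg_p: "G.avg (\<lambda>x. x e) = G.avg (p e)" for e
    unfolding p_def P_def by (rule G.avg_cond[symmetric])
  have avg_H: "G.avg (hamiltonian \<alpha> h n) \<le>
      G.avg (\<lambda>x. hamiltonian \<alpha> h n (\<lambda>e. p e x)) + 2 * \<bar>\<alpha>\<bar> * (real n)\<^sup>2 / real r"
  proof -
    have H: "hamiltonian \<alpha> h n q = \<alpha> / real n * T q + h * (\<Sum>e\<in>edges n. q e)" for q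
      by (simp add: hamiltonian_def T_def)
    have "G.avg (hamiltonian \<alpha> h n) = G.avg (\<lambda>x. \<alpha> / real n * T x + h * (\<Sum>e\<in>edges n. x e))"
      by (rule G.avg_cong) (rule H)
    also have "\<dots> = \<alpha> / real n * G.avg T + h * (\<Sum>e\<in>edges n. G.avg (p e))"
      by (simp only: G.avg_add G.avg_scale G.avg_sum avg_p)
    also have "\<dots> \<le> \<alpha> / real n * G.avg (\<lambda>x. T (\<lambda>e. p e x)) + h * (\<Sum>e\<in>edges n. G.avg (p e)) +
        2 * \<bar>\<alpha>\<bar> * (real n)\<^sup>2 / real r"
      using avg_T by linarith
    also have "\<alpha> / real n * G.avg (\<lambda>x. T (\<lambda>e. p e x)) + h * (\<Sum>e\<in>edges n. G.avg (p e)) =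
        G.avg (\<lambda>x. \<alpha> / real n * T (\<lambda>e. p e x) + h * (\<Sum>e\<in>edges n. p e x))"
      by (simp only: G.avg_add G.avg_scale G.avg_sum)
    also have "\<dots> = G.avg (\<lambda>x. hamiltonian \<alpha> h n (\<lambda>e. p e x))"
      by (rule G.avg_cong) (rule H[symmetric])
    finally show ?thesis .
  qed
  (* The competitor in the Gibbs inequality: choose the revealed edges uniformly, then all edges
     independently with the conditional probabilities. Revealed edges have conditional
     probability 0 or 1, so they are sampled consistently. *)
  define R where "R = revealed n V"
  define \<nu> where "\<nu> x = (\<Prod>e\<in>edges n. bern (p e x) (x e)) / 2 ^ card R" for x
  have bern_pos: "bern (p e x) (x e) > 0" if "x \<in> configs n" "e \<in> edges n" for x e
  proof (cases "x e = 1")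
    case True
    have "P V e x > 0"
      unfolding P_def using that True configs_edge[OF _ that(2)] by (intro G.cond_pos) force+
    then show ?thesis using True by (simp add: bern_def p_def)
  next
    case False
    then have "x e = 0" using configs_edge[OF that] by simp
    then have "G.cond (F V) (\<lambda>x. 1 - x e) x > 0"
      using that configs_edge[OF _ that(2)] by (intro G.cond_pos) force+
    then show ?thesis using False that(1) by (simp add: bern_def p_def P_def G.cond_compl)
  qed
  have \<nu>_pos: "\<nu> x > 0" if "x \<in> configs n" for x
    unfolding \<nu>_def using bern_pos[OF that] by (intro divide_pos_pos prod_pos) auto
  have "(\<Sum>x\<in>configs n. \<Prod>e\<in>edges n. bern (p e x) (x e)) \<le> 2 ^ card R"
  proof (rule sum_prod_bern_le)
    show "R \<subseteq> edges n" by (auto simp: R_def revealed_def)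
    show "p e x = p e y" if "restrict x R = restrict y R" for e x y
      unfolding p_def by (rule P_meas) (use that in \<open>simp add: F_def R_def\<close>)
  qed (use p01 in auto)
  then have "sum \<nu> (configs n) \<le> 1"
    by (simp add: \<nu>_def flip: sum_divide_distrib)
  with \<nu>_pos have "G.avg (\<lambda>x. ln (\<nu> x)) \<le> G.avg (\<lambda>x. ln (exp (hamiltonian \<alpha> h n x) / Z))"
    by (rule G.gibbs_inequality)
  also have "\<dots> = G.avg (hamiltonian \<alpha> h n) - ln Z"
    using Z by (simp add: ln_div G.avg_diff G.avg_const)
  also have "G.avg (\<lambda>x. ln (\<nu> x)) =
      G.avg (\<lambda>x. (\<Sum>e\<in>edges n. x e * ln (p e x) + (1 - x e) * ln (1 - p e x)) - real (card R) * ln 2)"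
  proof (rule G.avg_cong)
    fix x assume x: "x \<in> configs n"
    have "0 < (\<Prod>e\<in>edges n. bern (p e x) (x e))" by (intro prod_pos bern_pos[OF x])
    then have "ln (\<nu> x) = ln (\<Prod>e\<in>edges n. bern (p e x) (x e)) - real (card R) * ln 2"
      unfolding \<nu>_def by (subst ln_divide_pos) (simp_all add: ln_realpow)
    also have "ln (\<Prod>e\<in>edges n. bern (p e x) (x e)) = (\<Sum>e\<in>edges n. ln (bern (p e x) (x e)))"
      using less_imp_neq[OF bern_pos[OF x], symmetric] by (intro ln_prod finite_edges)
    also have "\<dots> = (\<Sum>e\<in>edges n. x e * ln (p e x) + (1 - x e) * ln (1 - p e x))"
      by (intro sum.cong refl ln_bern configs_edge[OF x])
    finally show "ln (\<nu> x) = (\<Sum>e\<in>edges n. x e * ln (p e x) + (1 - x e) * ln (1 - p e x)) - real (card R) * ln 2" .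
  qed
  also have "\<dots> = (\<Sum>e\<in>edges n. G.avg (\<lambda>x. x e * ln (p e x) + (1 - x e) * ln (1 - p e x))) - real (card R) * ln 2"
    by (simp only: G.avg_diff G.avg_sum G.avg_const)
  also have "(\<Sum>e\<in>edges n. G.avg (\<lambda>x. x e * ln (p e x) + (1 - x e) * ln (1 - p e x))) =
      (\<Sum>e\<in>edges n. G.avg (\<lambda>x. entropy_fun (p e x)))"
  proof (rule sum.cong[OF refl])
    fix e
    have *: "G.avg (\<lambda>x. x e * \<phi> (p e x)) = G.avg (\<lambda>x. p e x * \<phi> (p e x))" for \<phi> :: "real \<Rightarrow> real"
      unfolding p_def P_def[of V e]
      by (rule G.avg_cond_mult[symmetric], rule arg_cong[of _ _ \<phi>], rule G.cond_cong)
    show "G.avg (\<lambda>x. x e * ln (p e x) + (1 - x e) * ln (1 - p e x)) = G.avg (\<lambda>x. entropy_fun (p e x))"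
      unfolding entropy_fun_def using *[of ln] *[of "\<lambda>t. ln (1 - t)"]
      by (simp add: left_diff_distrib G.avg_add G.avg_diff)
  qed
  also have "\<dots> = G.avg (\<lambda>x. \<Sum>e\<in>edges n. entropy_fun (p e x))"
    by (rule G.avg_sum[symmetric])
  finally have "ln Z \<le> G.avg (hamiltonian \<alpha> h n) -
      G.avg (\<lambda>x. \<Sum>e\<in>edges n. entropy_fun (p e x)) + real (card R) * ln 2" by simp
  also have "\<dots> \<le> G.avg (\<lambda>x. mean_field \<alpha> h n (\<lambda>e. p e x)) + 2 * \<bar>\<alpha>\<bar> * (real n)\<^sup>2 / real r + real (card R) * ln 2"
    using avg_H by (simp add: mean_field_def G.avg_diff)
  also have "\<dots> \<le> ((real n)\<^sup>2 * m + \<bar>\<alpha>\<bar> * real n) + 2 * \<bar>\<alpha>\<bar> * (real n)\<^sup>2 / real r + (real n * (real r)\<^sup>2) * ln 2"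
  proof (intro add_mono mult_right_mono order_refl)
    have "G.avg (\<lambda>x. mean_field \<alpha> h n (\<lambda>e. p e x)) \<le> G.avg (\<lambda>x. (real n)\<^sup>2 * m + \<bar>\<alpha>\<bar> * real n)"
      using p01 by (intro G.avg_mono mean_field_le \<alpha> m) auto
    then show "G.avg (\<lambda>x. mean_field \<alpha> h n (\<lambda>e. p e x)) \<le> (real n)\<^sup>2 * m + \<bar>\<alpha>\<bar> * real n"
      by (simp only: G.avg_const)
    have "card R \<le> n * r\<^sup>2"
      unfolding R_def using card_revealed_le[OF V(2), of n] V(3) by (meson le_trans mult_le_mono2)
    then show "real (card R) \<le> real n * (real r)\<^sup>2"
      by (metis of_nat_le_iff of_nat_mult of_nat_power)
  qed simp
  finally show ?thesis by (simp add: Z_def)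
qed

section \<open>Exponential concentration of the edge density\<close>

lemma eventually_linear_le_quadratic:
  fixes C \<delta> :: real
  assumes "\<delta> > 0"
  shows "\<forall>\<^sub>F n in sequentially. C * real n \<le> \<delta> * (real n)\<^sup>2"
proof -
  have "\<forall>\<^sub>F n in sequentially. C / \<delta> \<le> real n"
    using filterlim_real_sequentially by (simp add: filterlim_at_top)
  then show ?thesis
  proof eventually_elim
    case (elim n)
    then have "C \<le> \<delta> * real n" using assms by (simp add: field_simps)
    then have "C * real n \<le> \<delta> * real n * real n" by (rule mult_right_mono) simp
    then show ?case by (simp add: power2_eq_square mult.assoc)
  qed
qed

text \<open>First fix \<open>r\<close> so large that the correlation error is at most \<open>\<delta>n\<^sup>2/2\<close>; what remains is linear in \<open>n\<close>.\<close>

lemma ln_partition_function_le_eventually: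
  assumes \<alpha>: "- 2 \<le> \<alpha>" and m: "\<And>v. 0 \<le> v \<Longrightarrow> v \<le> 1 \<Longrightarrow> scalar_fun \<alpha> h v \<le> m" and \<delta>: "\<delta> > 0"
  shows "\<forall>\<^sub>F n in sequentially. ln (partition_function \<alpha> h n) \<le> (real n)\<^sup>2 * (m + \<delta>)"
proof -
  obtain r :: nat where r: "4 * \<bar>\<alpha>\<bar> / \<delta> < real r" using reals_Archimedean2 by blast
  have r0: "r > 0" using r \<delta> by (cases "r = 0") (auto simp: divide_less_0_iff)
  have r\<delta>: "2 * \<bar>\<alpha>\<bar> / real r \<le> \<delta> / 2" using r r0 \<delta> by (simp add: field_simps)
  have "\<delta> / 2 > 0" using \<delta> by simp
  from eventually_linear_le_quadratic[OF this, of "\<bar>\<alpha>\<bar> + (real r)\<^sup>2 * ln 2"] eventually_gt_at_top[of 0]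
  show ?thesis
  proof eventually_elim
    case (elim n)
    have "ln (partition_function \<alpha> h n) \<le> (real n)\<^sup>2 * m + \<bar>\<alpha>\<bar> * real n +
        2 * \<bar>\<alpha>\<bar> * (real n)\<^sup>2 / real r + real n * (real r)\<^sup>2 * ln 2"
      using partition_function_le[OF \<alpha> m elim(2) r0] by blast
    also have "\<dots> = (real n)\<^sup>2 * m + (\<bar>\<alpha>\<bar> + (real r)\<^sup>2 * ln 2) * real n + (real n)\<^sup>2 * (2 * \<bar>\<alpha>\<bar> / real r)"
      by (simp add: algebra_simps)
    also have "\<dots> \<le> (real n)\<^sup>2 * m + \<delta> / 2 * (real n)\<^sup>2 + (real n)\<^sup>2 * (\<delta> / 2)"
      using elim(1) r\<delta> by (intro add_mono mult_left_mono order_refl) auto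
    finally show ?case by (simp add: algebra_simps)
  qed
qed

lemma ln_partition_function_ge_eventually:
  assumes u: "0 < u" "u < 1" and \<delta>: "\<delta> > 0"
  shows "\<forall>\<^sub>F n in sequentially. (real n)\<^sup>2 * (scalar_fun \<alpha> h u - \<delta>) \<le> ln (partition_function \<alpha> h n)"
  using eventually_linear_le_quadratic[OF \<delta>, of "scalar_fun \<alpha> h u + \<bar>\<alpha>\<bar>"] eventually_gt_at_top[of 0]
proof eventually_elim
  case (elim n)
  have "\<alpha> * u ^ 3 * (real n - 1) / 3 \<le> \<bar>\<alpha>\<bar> * real n"
  proof -
    have "\<bar>\<alpha>\<bar> * u ^ 3 * (real n - 1) \<le> \<bar>\<alpha>\<bar> * 1 * real n"
      using u elim(2) by (intro mult_mono mult_left_mono power_le_one) auto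
    moreover have "\<alpha> * u ^ 3 * (real n - 1) \<le> \<bar>\<alpha>\<bar> * u ^ 3 * (real n - 1)"
      using u elim(2) by (intro mult_right_mono) auto
    moreover have "0 \<le> \<bar>\<alpha>\<bar> * real n" by simp
    ultimately show ?thesis by linarith
  qed
  moreover have "mean_field \<alpha> h n (\<lambda>_. u) =
      (real n)\<^sup>2 * scalar_fun \<alpha> h u - scalar_fun \<alpha> h u * real n - \<alpha> * u ^ 3 * (real n - 1) / 3"
    using elim(2) by (subst mean_field_const) (auto simp: field_simps power2_eq_square)
  moreover have "(real n)\<^sup>2 * (scalar_fun \<alpha> h u - \<delta>) = (real n)\<^sup>2 * scalar_fun \<alpha> h u - \<delta> * (real n)\<^sup>2"
    by (simp add: algebra_simps)
  moreover have "(scalar_fun \<alpha> h u + \<bar>\<alpha>\<bar>) * real n = scalar_fun \<alpha> h u * real n + \<bar>\<alpha>\<bar> * real n"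
    by (simp add: algebra_simps)
  ultimately show ?case
    using elim(1) partition_function_ge[OF u, of \<alpha> h n] by linarith
qed

lemma measure_edge_triangle:
  "X \<subseteq> configs n \<Longrightarrow> measure (edge_triangle_measure \<alpha> h n) X =
     (\<Sum>x\<in>X. exp (hamiltonian \<alpha> h n x) / partition_function \<alpha> h n)"
  unfolding edge_triangle_measure_def measure_def
  using partition_function_pos[of \<alpha> h n]
  by (simp add: emeasure_point_measure_finite finite_configs sum_nonneg less_imp_le)

text \<open>Shifting the field by \<open>t\<close> multiplies the weight of \<open>x\<close> by \<open>exp (t * edge_count n x)\<close>, so the exponential
moment of the edge count is a ratio of partition functions.\<close>

lemma chernoff_edge_count:
  "measure (edge_triangle_measure \<alpha> h n) {x \<in> configs n. t * s \<le> t * edge_count n x} \<le>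
     exp (- (t * s) + ln (partition_function \<alpha> (h + t) n) - ln (partition_function \<alpha> h n))"
proof -
  let ?Z = "partition_function \<alpha> h n"
  have Z: "?Z > 0" "partition_function \<alpha> (h + t) n > 0" by (rule partition_function_pos)+
  have "measure (edge_triangle_measure \<alpha> h n) {x \<in> configs n. t * s \<le> t * edge_count n x} =
      (\<Sum>x | x \<in> configs n \<and> t * s \<le> t * edge_count n x. exp (hamiltonian \<alpha> h n x) / ?Z)"
    by (intro measure_edge_triangle) auto
  also have "\<dots> \<le> (\<Sum>x | x \<in> configs n \<and> t * s \<le> t * edge_count n x.
      exp (- (t * s)) * exp (hamiltonian \<alpha> (h + t) n x) / ?Z)"
  proof (rule sum_mono)
    fix x assume "x \<in> {x \<in> configs n. t * s \<le> t * edge_count n x}"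
    then have "hamiltonian \<alpha> h n x \<le> - (t * s) + hamiltonian \<alpha> (h + t) n x"
      by (simp add: hamiltonian_def edge_count_def algebra_simps)
    then have "exp (hamiltonian \<alpha> h n x) \<le> exp (- (t * s)) * exp (hamiltonian \<alpha> (h + t) n x)"
      by (simp only: exp_add[symmetric] exp_le_cancel_iff)
    then show "exp (hamiltonian \<alpha> h n x) / ?Z \<le> exp (- (t * s)) * exp (hamiltonian \<alpha> (h + t) n x) / ?Z"
      using Z(1) by (intro divide_right_mono) auto
  qed
  also have "\<dots> \<le> (\<Sum>x\<in>configs n. exp (- (t * s)) * exp (hamiltonian \<alpha> (h + t) n x) / ?Z)"
    using Z(1) by (intro sum_mono2 finite_configs) auto
  also have "\<dots> = exp (- (t * s)) * partition_function \<alpha> (h + t) n / ?Z"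
    by (simp add: partition_function_def[of _ "h + t"] sum_distrib_left sum_divide_distrib)
  also have "\<dots> = exp (- (t * s) + ln (partition_function \<alpha> (h + t) n) - ln ?Z)"
    using Z by (simp only: exp_diff exp_add exp_ln)
  finally show ?thesis .
qed

text \<open>This is differentiability of the maximum in the field, with derivative \<open>u/2\<close>. Away from \<open>u\<close> the
functional stays below its maximum by a fixed gap, by compactness; a tilt \<open>t\<close> equal to that gap
cannot close it, and near \<open>u\<close> the tilt contributes about \<open>\<sigma>tu/2\<close>. The sign \<open>\<sigma>\<close> treats both tails at once.\<close>

lemma tilted_scalar_bound:
  assumes u: "maximizers \<alpha> h = {u}" and \<epsilon>: "\<epsilon> > 0" and \<sigma>: "\<bar>\<sigma>\<bar> = (1::real)"
  shows "\<exists>t>0. \<forall>v. 0 \<le> v \<longrightarrow> v \<le> 1 \<longrightarrow>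
    scalar_fun \<alpha> (h + \<sigma> * t) v \<le> scalar_fun \<alpha> h u + \<sigma> * t * u / 2 + t * \<epsilon> / 4"
proof -
  have u01: "0 \<le> u" "u \<le> 1" and max: "\<And>v. 0 \<le> v \<Longrightarrow> v \<le> 1 \<Longrightarrow> scalar_fun \<alpha> h v \<le> scalar_fun \<alpha> h u"
    using u by (auto simp: set_eq_iff maximizers_iff)
  define K where "K = {0..1} \<inter> {v. \<epsilon> / 2 \<le> \<bar>v - u\<bar>}"
  have "compact K"
    unfolding K_def by (intro compact_Int_closed closed_Collect_le continuous_intros) auto
  obtain t where t: "t > 0" "\<And>v. v \<in> K \<Longrightarrow> scalar_fun \<alpha> h v \<le> scalar_fun \<alpha> h u - t"
  proof (cases "K = {}")
    case True
    then show ?thesis using that[of 1] by auto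
  next
    case False
    have "continuous_on K (scalar_fun \<alpha> h)"
      by (rule continuous_on_subset[OF continuous_on_scalar_fun]) (auto simp: K_def)
    then obtain w where w: "w \<in> K" "\<And>v. v \<in> K \<Longrightarrow> scalar_fun \<alpha> h v \<le> scalar_fun \<alpha> h w"
      using continuous_attains_sup[OF \<open>compact K\<close> False] by blast
    have "w \<noteq> u" using w(1) \<epsilon> by (auto simp: K_def)
    then have "w \<notin> maximizers \<alpha> h" using u by simp
    then obtain v where "0 \<le> v" "v \<le> 1" "scalar_fun \<alpha> h w < scalar_fun \<alpha> h v"
      using w(1) by (auto simp: maximizers_iff K_def not_le)
    then have "scalar_fun \<alpha> h w < scalar_fun \<alpha> h u" using max[of v] by simp
    then show ?thesis using that[of "scalar_fun \<alpha> h u - scalar_fun \<alpha> h w"] w(2) by simp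
  qed
  have "scalar_fun \<alpha> (h + \<sigma> * t) v \<le> scalar_fun \<alpha> h u + \<sigma> * t * u / 2 + t * \<epsilon> / 4"
    if v: "0 \<le> v" "v \<le> 1" for v
  proof -
    have shift: "scalar_fun \<alpha> (h + \<sigma> * t) v = scalar_fun \<alpha> h v + \<sigma> * t * u / 2 + t * (\<sigma> * (v - u)) / 2"
      by (simp add: scalar_fun_def field_simps)
    have "\<sigma> * (v - u) \<le> \<bar>v - u\<bar>" using abs_ge_self[of "\<sigma> * (v - u)"] \<sigma> by (simp add: abs_mult)
    then have le: "t * (\<sigma> * (v - u)) \<le> t * \<bar>v - u\<bar>" using t(1) by (intro mult_left_mono) auto
    show ?thesis
    proof (cases "v \<in> K")
      case True
      have "t * \<bar>v - u\<bar> \<le> t * 1" using t(1) v u01 by (intro mult_left_mono) auto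
      moreover have "0 \<le> t * \<epsilon>" using t(1) \<epsilon> by simp
      ultimately show ?thesis using shift le t(2)[OF True] t(1) by linarith
    next
      case False
      then have "t * \<bar>v - u\<bar> \<le> t * (\<epsilon> / 2)" using t(1) v by (intro mult_left_mono) (auto simp: K_def)
      then show ?thesis using shift le max[OF v] by simp
    qed
  qed
  then show ?thesis using t(1) by blast
qed

text \<open>Chernoff's inequality compares the partition functions at the fields \<open>h + \<sigma>t\<close> and \<open>h\<close>. On the scale
\<open>n\<^sup>2\<close> a deviation \<open>\<epsilon>\<close> gains \<open>t\<epsilon>/2\<close>, the tilt costs \<open>t\<epsilon>/4\<close>, and the two free energy errors cost \<open>\<delta> = t\<epsilon>/16\<close>
each, which leaves the rate \<open>2\<delta>\<close>.\<close>

lemma edge_density_one_sided: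
  assumes \<alpha>: "- 2 \<le> \<alpha>" and u: "maximizers \<alpha> h = {u}" and \<epsilon>: "\<epsilon> > 0" and \<sigma>: "\<bar>\<sigma>\<bar> = (1::real)"
  shows "\<exists>c>0. \<forall>\<^sub>F n in sequentially. measure (edge_triangle_measure \<alpha> h n)
    {x \<in> configs n. \<epsilon> \<le> \<sigma> * (2 * edge_count n x / (real n)\<^sup>2 - u)} \<le> exp (- c * (real n)\<^sup>2)"
proof -
  obtain t where t: "t > 0" "\<And>v. 0 \<le> v \<Longrightarrow> v \<le> 1 \<Longrightarrow>
      scalar_fun \<alpha> (h + \<sigma> * t) v \<le> scalar_fun \<alpha> h u + \<sigma> * t * u / 2 + t * \<epsilon> / 4"
    using tilted_scalar_bound[OF u \<epsilon> \<sigma>] by blast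
  define \<delta> where "\<delta> = t * \<epsilon> / 16"
  have \<delta>: "\<delta> > 0" using t \<epsilon> by (simp add: \<delta>_def)
  have u01: "0 < u" "u < 1" using u maximizer_interior[of u \<alpha> h] by auto
  from \<sigma> have \<sigma>2: "\<sigma> * \<sigma> = 1" by (simp add: abs_if split: if_splits)
  have "\<forall>\<^sub>F n in sequentially. ln (partition_function \<alpha> (h + \<sigma> * t) n) \<le>
      (real n)\<^sup>2 * (scalar_fun \<alpha> h u + \<sigma> * t * u / 2 + t * \<epsilon> / 4 + \<delta>)"
    by (rule ln_partition_function_le_eventually[OF \<alpha> _ \<delta>]) (rule t(2))
  from this ln_partition_function_ge_eventually[OF u01 \<delta>, of \<alpha> h]
    eventually_gt_at_top[of 0]
  have "\<forall>\<^sub>F n in sequentially. measure (edge_triangle_measure \<alpha> h n)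
    {x \<in> configs n. \<epsilon> \<le> \<sigma> * (2 * edge_count n x / (real n)\<^sup>2 - u)} \<le> exp (- (2 * \<delta>) * (real n)\<^sup>2)"
  proof eventually_elim
    case (elim n)
    define s where "s = (real n)\<^sup>2 * (u + \<sigma> * \<epsilon>) / 2"
    have s: "\<sigma> * t * s = (real n)\<^sup>2 * (\<sigma> * t * u / 2 + t * \<epsilon> / 2)"
    proof -
      have "\<sigma> * t * s = (real n)\<^sup>2 * (\<sigma> * t * u / 2 + (\<sigma> * \<sigma>) * t * \<epsilon> / 2)"
        by (simp add: s_def algebra_simps)
      then show ?thesis by (simp add: \<sigma>2)
    qed
    have "\<epsilon> \<le> \<sigma> * (2 * edge_count n x / (real n)\<^sup>2 - u) \<longleftrightarrow> \<sigma> * t * s \<le> \<sigma> * t * edge_count n x" for x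
    proof -
      define N where "N = (real n)\<^sup>2"
      have N: "N > 0" using elim(3) by (simp add: N_def)
      have "\<sigma> * t * edge_count n x - \<sigma> * t * s =
          N * t / 2 * (\<sigma> * (2 * edge_count n x / N - u) - \<epsilon>)"
        unfolding s N_def[symmetric] using N by (simp add: field_simps)
      moreover have "N * t / 2 > 0" using N t(1) by simp
      moreover have "0 \<le> c * d \<longleftrightarrow> 0 \<le> d" if "c > 0" for c d :: real
        using that by (simp add: zero_le_mult_iff)
      ultimately have "0 \<le> \<sigma> * t * edge_count n x - \<sigma> * t * s \<longleftrightarrow>
          0 \<le> \<sigma> * (2 * edge_count n x / N - u) - \<epsilon>"
        by (simp only:)
      then show ?thesis
        unfolding N_def[symmetric] by (simp only: diff_ge_0_iff_ge)
    qed
    then have "measure (edge_triangle_measure \<alpha> h n)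
        {x \<in> configs n. \<epsilon> \<le> \<sigma> * (2 * edge_count n x / (real n)\<^sup>2 - u)} \<le>
        exp (- (\<sigma> * t * s) + ln (partition_function \<alpha> (h + \<sigma> * t) n) - ln (partition_function \<alpha> h n))"
      using chernoff_edge_count[of \<alpha> h n "\<sigma> * t" s] by simp
    also have "\<dots> \<le> exp (- (2 * \<delta>) * (real n)\<^sup>2)"
    proof (subst exp_le_cancel_iff)
      have "- (\<sigma> * t * s) + (real n)\<^sup>2 * (scalar_fun \<alpha> h u + \<sigma> * t * u / 2 + t * \<epsilon> / 4 + \<delta>) -
          (real n)\<^sup>2 * (scalar_fun \<alpha> h u - \<delta>) = - (2 * \<delta>) * (real n)\<^sup>2"
        unfolding s \<delta>_def by (simp add: field_simps)
      then show "- (\<sigma> * t * s) + ln (partition_function \<alpha> (h + \<sigma> * t) n) - ln (partition_function \<alpha> h n)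
          \<le> - (2 * \<delta>) * (real n)\<^sup>2"
        using elim(1,2) by linarith
    qed
    finally show ?case .
  qed
  moreover have "2 * \<delta> > 0" using \<delta> by simp
  ultimately show ?thesis by blast
qed

lemma edge_density_concentration:
  assumes \<alpha>: "- 2 \<le> \<alpha>" and u: "maximizers \<alpha> h = {u}" and \<epsilon>: "\<epsilon> > 0"
  shows "summable (\<lambda>n. measure (edge_triangle_measure \<alpha> h n)
    {x \<in> configs n. \<epsilon> \<le> \<bar>2 * edge_count n x / (real n)\<^sup>2 - u\<bar>})"
proof -
  obtain c where c: "c > 0" "\<forall>\<^sub>F n in sequentially. measure (edge_triangle_measure \<alpha> h n)
      {x \<in> configs n. \<epsilon> \<le> 1 * (2 * edge_count n x / (real n)\<^sup>2 - u)} \<le> exp (- c * (real n)\<^sup>2)"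
    using edge_density_one_sided[OF \<alpha> u \<epsilon>, of 1] by auto
  obtain d where d: "d > 0" "\<forall>\<^sub>F n in sequentially. measure (edge_triangle_measure \<alpha> h n)
      {x \<in> configs n. \<epsilon> \<le> - 1 * (2 * edge_count n x / (real n)\<^sup>2 - u)} \<le> exp (- d * (real n)\<^sup>2)"
    using edge_density_one_sided[OF \<alpha> u \<epsilon>, of "- 1"] by auto
  have geo: "exp (- a * (real n)\<^sup>2) \<le> exp (- a) ^ n" if "a > 0" for a and n :: nat
  proof -
    have "real n \<le> (real n)\<^sup>2" by (metis of_nat_le_iff of_nat_power le_square power2_eq_square)
    then have "a * real n \<le> a * (real n)\<^sup>2" using that by (intro mult_left_mono) auto
    then show ?thesis by (simp flip: exp_of_nat_mult add: mult.commute)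
  qed
  have "summable (\<lambda>n. exp (- c) ^ n + exp (- d) ^ n)"
    using c(1) d(1) by (intro summable_add summable_geometric) auto
  moreover have "\<forall>\<^sub>F n in sequentially. norm (measure (edge_triangle_measure \<alpha> h n)
      {x \<in> configs n. \<epsilon> \<le> \<bar>2 * edge_count n x / (real n)\<^sup>2 - u\<bar>}) \<le> exp (- c) ^ n + exp (- d) ^ n"
    using c(2) d(2)
  proof eventually_elim
    case (elim n)
    have "sets (edge_triangle_measure \<alpha> h n) = Pow (configs n)"
      by (simp add: edge_triangle_measure_def sets_point_measure)
    then have "measure (edge_triangle_measure \<alpha> h n)
        ({x \<in> configs n. \<epsilon> \<le> 1 * (2 * edge_count n x / (real n)\<^sup>2 - u)} \<union>
         {x \<in> configs n. \<epsilon> \<le> - 1 * (2 * edge_count n x / (real n)\<^sup>2 - u)}) \<le>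
        exp (- c * (real n)\<^sup>2) + exp (- d * (real n)\<^sup>2)"
      by (intro order_trans[OF measure_Un_le add_mono[OF elim]]) auto
    moreover have "{x \<in> configs n. \<epsilon> \<le> 1 * (2 * edge_count n x / (real n)\<^sup>2 - u)} \<union>
         {x \<in> configs n. \<epsilon> \<le> - 1 * (2 * edge_count n x / (real n)\<^sup>2 - u)} =
        {x \<in> configs n. \<epsilon> \<le> \<bar>2 * edge_count n x / (real n)\<^sup>2 - u\<bar>}"
      by auto
    ultimately show ?case
      using geo[OF c(1), of n] geo[OF d(1), of n] by simp
  qed
  ultimately show ?thesis by (rule summable_comparison_test_ev[rotated])
qed

section \<open>Almost sure convergence\<close>

text \<open>The first Borel-Cantelli lemma, applied to the countably many deviations \<open>1/(j+1)\<close>.\<close>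

lemma AE_LIMSEQ_of_summable_deviations:
  fixes X :: "nat \<Rightarrow> 'w \<Rightarrow> real"
  assumes "prob_space M" "\<And>n. X n \<in> borel_measurable M"
    and sum: "\<And>\<epsilon>. \<epsilon> > 0 \<Longrightarrow> summable (\<lambda>n. measure M {\<omega> \<in> space M. \<epsilon> \<le> \<bar>X n \<omega> - u\<bar>})"
  shows "AE \<omega> in M. (\<lambda>n. X n \<omega>) \<longlonglongrightarrow> u"
proof -
  interpret prob_space M by fact
  have [measurable]: "X n \<in> borel_measurable M" for n by fact
  have "AE \<omega> in M. \<forall>\<^sub>F n in sequentially. \<omega> \<in> space M - {\<omega> \<in> space M. 1 / Suc j \<le> \<bar>X n \<omega> - u\<bar>}" for j
    using sum[of "1 / Suc j"] by (intro borel_cantelli_AE1) (auto simp: emeasure_eq_measure)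
  then have "AE \<omega> in M. \<forall>j. \<forall>\<^sub>F n in sequentially. \<omega> \<in> space M - {\<omega> \<in> space M. 1 / Suc j \<le> \<bar>X n \<omega> - u\<bar>}"
    by (simp add: AE_all_countable)
  then show ?thesis
  proof (rule eventually_mono)
    fix \<omega> assume ev: "\<forall>j. \<forall>\<^sub>F n in sequentially. \<omega> \<in> space M - {\<omega> \<in> space M. 1 / Suc j \<le> \<bar>X n \<omega> - u\<bar>}"
    show "(\<lambda>n. X n \<omega>) \<longlonglongrightarrow> u"
    proof (rule tendstoI)
      fix e :: real assume "e > 0"
      then obtain j where j: "1 / real (Suc j) < e" using nat_approx_posE by blast
      from ev have "\<forall>\<^sub>F n in sequentially. \<omega> \<in> space M - {\<omega> \<in> space M. 1 / Suc j \<le> \<bar>X n \<omega> - u\<bar>}" ..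
      then show "\<forall>\<^sub>F n in sequentially. dist (X n \<omega>) u < e"
        by (rule eventually_mono) (use j in \<open>auto simp: dist_real_def\<close>)
    qed
  qed
qed

theorem theorem3p2:
  fixes \<alpha> h :: real and M :: "'w measure" and S :: "nat \<Rightarrow> 'w \<Rightarrow> real"
  assumes "(\<alpha>, h) \<in> uniqueness_region"
    and "prob_space M"
    and "\<And>n. n \<ge> 1 \<Longrightarrow> S n \<in> borel_measurable M"
    and "\<And>n. n \<ge> 1 \<Longrightarrow>
           distr M borel (S n) = distr (edge_triangle_measure \<alpha> h n) borel (edge_count n)"
  shows "maximizers \<alpha> h = {u_star \<alpha> h} \<and>
         (AE \<omega> in M. (\<lambda>n. 2 * S n \<omega> / (real n)\<^sup>2) \<longlonglongrightarrow> u_star \<alpha> h)"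
proof
  show max: "maximizers \<alpha> h = {u_star \<alpha> h}"
    using assms(1) by (rule uniqueness_region_maximizers)
  have \<alpha>: "- 2 \<le> \<alpha>" using assms(1) by (simp add: uniqueness_region_def)
  (* At n = 0, where S 0 need not be measurable, division by zero makes X vanish. *)
  define X where "X n \<omega> = 2 * S n \<omega> / (real n)\<^sup>2" for n \<omega>
  have meas: "X n \<in> borel_measurable M" for n
  proof (cases "n = 0")
    case False
    then have [measurable]: "S n \<in> borel_measurable M" using assms(3)[of n] by simp
    show ?thesis unfolding X_def by measurable
  qed (simp add: X_def[abs_def])
  have law: "measure M {\<omega> \<in> space M. \<epsilon> \<le> \<bar>X n \<omega> - u_star \<alpha> h\<bar>} =
      measure (edge_triangle_measure \<alpha> h n)
        {x \<in> configs n. \<epsilon> \<le> \<bar>2 * edge_count n x / (real n)\<^sup>2 - u_star \<alpha> h\<bar>}" if n: "n \<ge> 1" for n \<epsilon>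
  proof -
    define B where "B = {y. \<epsilon> \<le> \<bar>2 * y / (real n)\<^sup>2 - u_star \<alpha> h\<bar>}"
    have B: "B \<in> sets borel" unfolding B_def by measurable
    have sp: "space (edge_triangle_measure \<alpha> h n) = configs n"
      by (simp add: edge_triangle_measure_def space_point_measure)
    have "edge_count n \<in> borel_measurable (edge_triangle_measure \<alpha> h n)"
      by (simp add: edge_triangle_measure_def)
    then have "measure (edge_triangle_measure \<alpha> h n) (edge_count n -` B \<inter> configs n) =
        measure (distr M borel (S n)) B"
      using B n assms(4)[of n] by (simp add: measure_distr sp)
    also have "\<dots> = measure M (S n -` B \<inter> space M)"
      using B n assms(3)[of n] by (simp add: measure_distr)
    also have "S n -` B \<inter> space M = {\<omega> \<in> space M. \<epsilon> \<le> \<bar>X n \<omega> - u_star \<alpha> h\<bar>}"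
      by (auto simp: B_def X_def)
    also have "edge_count n -` B \<inter> configs n =
        {x \<in> configs n. \<epsilon> \<le> \<bar>2 * edge_count n x / (real n)\<^sup>2 - u_star \<alpha> h\<bar>}"
      by (auto simp: B_def)
    finally show ?thesis by simp
  qed
  have "summable (\<lambda>n. measure M {\<omega> \<in> space M. \<epsilon> \<le> \<bar>X n \<omega> - u_star \<alpha> h\<bar>})" if "\<epsilon> > 0" for \<epsilon>
  proof (rule summable_cong[THEN iffD2, OF _ edge_density_concentration[OF \<alpha> max that]])
    show "\<forall>\<^sub>F n in sequentially. measure M {\<omega> \<in> space M. \<epsilon> \<le> \<bar>X n \<omega> - u_star \<alpha> h\<bar>} =
        measure (edge_triangle_measure \<alpha> h n)
          {x \<in> configs n. \<epsilon> \<le> \<bar>2 * edge_count n x / (real n)\<^sup>2 - u_star \<alpha> h\<bar>}"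
      using eventually_ge_at_top[of 1] by eventually_elim (rule law)
  qed
  with assms(2) meas have "AE \<omega> in M. (\<lambda>n. X n \<omega>) \<longlonglongrightarrow> u_star \<alpha> h"
    by (rule AE_LIMSEQ_of_summable_deviations)
  then show "AE \<omega> in M. (\<lambda>n. 2 * S n \<omega> / (real n)\<^sup>2) \<longlonglongrightarrow> u_star \<alpha> h"
    by (simp add: X_def)
qed

end
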